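(* Let $\Bbbk$ be a field and let $\mathcal{G}$ be a digraph with vertex set $V(\mathcal{G})$ and edge set $E(\mathcal{G})$. There is a $\Bbbk$-coalgebra $C(\mathcal{G})$ such that $G\big(C(\mathcal{G})\big) = V(\mathcal{G})$ and the restriction map $\operatorname{Aut}\big(C(\mathcal{G})\big)\to \operatorname{Sym}\big(G(C(\mathcal{G}))\big) = \operatorname{Sym}\big(V(\mathcal{G})\big)$ induces a split short exact sequence of groups \[1\longrightarrow\prod_{e\in E(\mathcal{G})}\left(\Bbbk\rtimes\Bbbk^\times\right) \longrightarrow \operatorname{Aut}\big(C(\mathcal{G})\big)\longrightarrow \operatorname{Aut}(\mathcal{G})\longrightarrow 1.\]
   Context: A digraph $\mathcal{G}$ consists of a (possibly infinite) set $V(\mathcal{G})$ of vertices and a set $E(\mathcal{G})\subseteq V(\mathcal{G})\times V(\mathcal{G})$ of edges. $\operatorname{Aut}(\mathcal{G})$ is the group of bijections $\sigma$ of $V(\mathcal{G})$ such that $(v,w)\in E(\mathcal{G})$ if and only if $(\sigma(v),\sigma(w))\in E(\mathcal{G})$; it is regarded as a subgroup of $\operatorname{Sym}(V(\mathcal{G}))$. Coalgebras are coassociative and counital. For a coalgebra $(C,\Delta,\varepsilon)$, $G(C)=\{c\in C\mid \Delta(c)=c\otimes c,\ \varepsilon(c)=1\}$ is the set of grouplike elements and $\operatorname{Aut}(C)$ is the group of coalgebra automorphisms; every coalgebra automorphism permutes $G(C)$, and the restriction map sends $f$ to $f|_{G(C)}$. $\operatorname{Sym}(X)$ is the group of all permutations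 of a set $X$. In $\Bbbk\rtimes\Bbbk^\times$, the multiplicative group $\Bbbk^\times$ acts on the additive group $\Bbbk$ by multiplication. The product of groups is the full (unrestricted) direct product. *)

theory Defs
  imports
    "HOL-Algebra.Module" "HOL-Algebra.AbelCoset" "HOL-Algebra.Bij" "HOL-Algebra.Product_Groups"
    "HOL-Algebra.Multiplicative_Group" "HOL-Algebra.Exact_Sequence"
    "Graph_Theory.Pair_Digraph"
begin

section \<open>Tensor products of modules\<close>

text \<open>The multiplicative fields that \<^type>\<open>module\<close> inherits from \<^type>\<open>ring\<close> play no role in
  a module and are left undefined below.\<close>

definition linear_maps ::
  "('k, 'r) ring_scheme \<Rightarrow> ('k, 'a, 'm) module_scheme \<Rightarrow> ('k, 'b, 'n) module_scheme \<Rightarrow> ('a \<Rightarrow> 'b) set"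
  where "linear_maps K M N =
    {f \<in> carrier M \<rightarrow> carrier N.
      (\<forall>x \<in> carrier M. \<forall>y \<in> carrier M. f (x \<oplus>\<^bsub>M\<^esub> y) = f x \<oplus>\<^bsub>N\<^esub> f y) \<and>
      (\<forall>a \<in> carrier K. \<forall>x \<in> carrier M. f (a \<odot>\<^bsub>M\<^esub> x) = a \<odot>\<^bsub>N\<^esub> f x)}"

definition regular_module :: "('k, 'r) ring_scheme \<Rightarrow> ('k, 'k) module"
  where "regular_module K =
    \<lparr>carrier = carrier K, monoid.mult = undefined, one = undefined,
     ring.zero = \<zero>\<^bsub>K\<^esub>, ring.add = (\<oplus>\<^bsub>K\<^esub>), smult = (\<otimes>\<^bsub>K\<^esub>)\<rparr>"

definition free_module :: "('k, 'r) ring_scheme \<Rightarrow> 'x set \<Rightarrow> ('k, 'x \<Rightarrow> 'k) module"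
  where "free_module K B =
    \<lparr>carrier = {u \<in> UNIV \<rightarrow> carrier K. finite {x. u x \<noteq> \<zero>\<^bsub>K\<^esub>} \<and> (\<forall>x. x \<notin> B \<longrightarrow> u x = \<zero>\<^bsub>K\<^esub>)},
     monoid.mult = undefined, one = undefined,
     ring.zero = (\<lambda>x. \<zero>\<^bsub>K\<^esub>), ring.add = (\<lambda>u w x. u x \<oplus>\<^bsub>K\<^esub> w x), smult = (\<lambda>a u x. a \<otimes>\<^bsub>K\<^esub> u x)\<rparr>"

definition free_gen :: "('k, 'r) ring_scheme \<Rightarrow> 'x \<Rightarrow> 'x \<Rightarrow> 'k"
  where "free_gen K x = (\<lambda>y. if y = x then \<one>\<^bsub>K\<^esub> else \<zero>\<^bsub>K\<^esub>)"

definition generated_submodule ::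
  "('k, 'r) ring_scheme \<Rightarrow> ('k, 'a, 'm) module_scheme \<Rightarrow> 'a set \<Rightarrow> 'a set"
  where "generated_submodule K M A = \<Inter>{S. submodule S K M \<and> A \<subseteq> S}"

definition quotient_module :: "('k, 'a, 'm) module_scheme \<Rightarrow> 'a set \<Rightarrow> ('k, 'a set) module"
  where "quotient_module M S =
    \<lparr>carrier = a_rcosets\<^bsub>M\<^esub> S, monoid.mult = undefined, one = undefined,
     ring.zero = S, ring.add = (<+>\<^bsub>M\<^esub>), smult = (\<lambda>a A. \<Union>x\<in>A. S +>\<^bsub>M\<^esub> (a \<odot>\<^bsub>M\<^esub> x))\<rparr>"

definition tensor_relations ::
  "('k, 'r) ring_scheme \<Rightarrow> ('k, 'a, 'm) module_scheme \<Rightarrow> ('k, 'b, 'n) module_scheme \<Rightarrow>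
   ('a \<times> 'b \<Rightarrow> 'k) set"
  where "tensor_relations K M N =
    (let F = free_module K (carrier M \<times> carrier N) in
      {free_gen K (x \<oplus>\<^bsub>M\<^esub> x', y) \<ominus>\<^bsub>F\<^esub> (free_gen K (x, y) \<oplus>\<^bsub>F\<^esub> free_gen K (x', y)) | x x' y.
        x \<in> carrier M \<and> x' \<in> carrier M \<and> y \<in> carrier N} \<union>
      {free_gen K (x, y \<oplus>\<^bsub>N\<^esub> y') \<ominus>\<^bsub>F\<^esub> (free_gen K (x, y) \<oplus>\<^bsub>F\<^esub> free_gen K (x, y')) | x y y'.
        x \<in> carrier M \<and> y \<in> carrier N \<and> y' \<in> carrier N} \<union>
      {free_gen K (a \<odot>\<^bsub>M\<^esub> x, y) \<ominus>\<^bsub>F\<^esub> (a \<odot>\<^bsub>F\<^esub> free_gen K (x, y)) | a x y.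
        a \<in> carrier K \<and> x \<in> carrier M \<and> y \<in> carrier N} \<union>
      {free_gen K (x, a \<odot>\<^bsub>N\<^esub> y) \<ominus>\<^bsub>F\<^esub> (a \<odot>\<^bsub>F\<^esub> free_gen K (x, y)) | a x y.
        a \<in> carrier K \<and> x \<in> carrier M \<and> y \<in> carrier N})"

definition tensor_kernel ::
  "('k, 'r) ring_scheme \<Rightarrow> ('k, 'a, 'm) module_scheme \<Rightarrow> ('k, 'b, 'n) module_scheme \<Rightarrow>
   ('a \<times> 'b \<Rightarrow> 'k) set"
  where "tensor_kernel K M N =
    generated_submodule K (free_module K (carrier M \<times> carrier N)) (tensor_relations K M N)"

definition tensor_product ::
  "('k, 'r) ring_scheme \<Rightarrow> ('k, 'a, 'm) module_scheme \<Rightarrow> ('k, 'b, 'n) module_scheme \<Rightarrow>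
   ('k, ('a \<times> 'b \<Rightarrow> 'k) set) module"
  where "tensor_product K M N =
    quotient_module (free_module K (carrier M \<times> carrier N)) (tensor_kernel K M N)"

definition pure_tensor ::
  "('k, 'r) ring_scheme \<Rightarrow> ('k, 'a, 'm) module_scheme \<Rightarrow> ('k, 'b, 'n) module_scheme \<Rightarrow>
   'a \<Rightarrow> 'b \<Rightarrow> ('a \<times> 'b \<Rightarrow> 'k) set"
  where "pure_tensor K M N x y =
    tensor_kernel K M N +>\<^bsub>free_module K (carrier M \<times> carrier N)\<^esub> free_gen K (x, y)"

text \<open>The linear map out of the tensor product of \<open>M\<close> and \<open>N\<close> induced by a bilinear map \<open>\<beta>\<close> into
  \<open>P\<close>.  For bilinear \<open>\<beta>\<close> the value does not depend on the representative \<open>u\<close> of the coset \<open>t\<close>.\<close>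

definition tensor_lift ::
  "('k, 'r) ring_scheme \<Rightarrow> ('k, 'p, 'q) module_scheme \<Rightarrow> ('a \<Rightarrow> 'b \<Rightarrow> 'p) \<Rightarrow>
   ('a \<times> 'b \<Rightarrow> 'k) set \<Rightarrow> 'p"
  where "tensor_lift K P \<beta> t =
    (let u = (SOME u. u \<in> t)
     in \<Oplus>\<^bsub>P\<^esub>p \<in> {p. u p \<noteq> \<zero>\<^bsub>K\<^esub>}. u p \<odot>\<^bsub>P\<^esub> \<beta> (fst p) (snd p))"

text \<open>The map \<open>f \<otimes> g\<close>, where \<open>M\<close> and \<open>N\<close> are the codomains of \<open>f\<close> and \<open>g\<close>.\<close>

definition tensor_map ::
  "('k, 'r) ring_scheme \<Rightarrow> ('k, 'c, 'm) module_scheme \<Rightarrow> ('k, 'd, 'n) module_scheme \<Rightarrow>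
   ('a \<Rightarrow> 'c) \<Rightarrow> ('b \<Rightarrow> 'd) \<Rightarrow> ('a \<times> 'b \<Rightarrow> 'k) set \<Rightarrow> ('c \<times> 'd \<Rightarrow> 'k) set"
  where "tensor_map K M N f g =
    tensor_lift K (tensor_product K M N) (\<lambda>x y. pure_tensor K M N (f x) (g y))"

text \<open>The canonical isomorphism \<open>(L \<otimes> M) \<otimes> N \<rightarrow> L \<otimes> (M \<otimes> N)\<close>.\<close>

definition tensor_assoc ::
  "('k, 'r) ring_scheme \<Rightarrow> ('k, 'a, 'l) module_scheme \<Rightarrow> ('k, 'b, 'm) module_scheme \<Rightarrow>
   ('k, 'c, 'n) module_scheme \<Rightarrow>
   (('a \<times> 'b \<Rightarrow> 'k) set \<times> 'c \<Rightarrow> 'k) set \<Rightarrow> ('a \<times> ('b \<times> 'c \<Rightarrow> 'k) set \<Rightarrow> 'k) set"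
  where "tensor_assoc K L M N =
    (let MN = tensor_product K M N; T = tensor_product K L MN
     in tensor_lift K T
          (\<lambda>t z. tensor_lift K T (\<lambda>x y. pure_tensor K L MN x (pure_tensor K M N y z)) t))"


section \<open>Coalgebras\<close>

record ('k, 'c) coalgebra = "('k, 'c) module" +
  comult :: "'c \<Rightarrow> ('c \<times> 'c \<Rightarrow> 'k) set"
  counit :: "'c \<Rightarrow> 'k"

text \<open>The two counit axioms use the canonical identifications of \<open>K \<otimes> C\<close> and \<open>C \<otimes> K\<close> with \<open>C\<close>.\<close>

locale coalgebra = K?: field K + C?: module K C
  for K :: "('k, 'r) ring_scheme" (structure) and C :: "('k, 'c, 'm) coalgebra_scheme" (structure) +
  assumes comult_linear: "comult C \<in> linear_maps K C (tensor_product K C C)"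
    and counit_linear: "counit C \<in> linear_maps K C (regular_module K)"
    and coassociative: "c \<in> carrier C \<Longrightarrow>
      tensor_assoc K C C C (tensor_map K (tensor_product K C C) C (comult C) id (comult C c)) =
      tensor_map K C (tensor_product K C C) id (comult C) (comult C c)"
    and counital_left: "c \<in> carrier C \<Longrightarrow>
      tensor_lift K C (\<lambda>x y. counit C x \<odot>\<^bsub>C\<^esub> y) (comult C c) = c"
    and counital_right: "c \<in> carrier C \<Longrightarrow>
      tensor_lift K C (\<lambda>x y. counit C y \<odot>\<^bsub>C\<^esub> x) (comult C c) = c"

definition grouplikes :: "('k, 'r) ring_scheme \<Rightarrow> ('k, 'c, 'm) coalgebra_scheme \<Rightarrow> 'c set"
  where "grouplikes K C =
    {c \<in> carrier C. comult C c = pure_tensor K C C c c \<and> counit C c = \<one>\<^bsub>K\<^esub>}"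

definition coalgebra_auto ::
  "('k, 'r) ring_scheme \<Rightarrow> ('k, 'c, 'm) coalgebra_scheme \<Rightarrow> ('c \<Rightarrow> 'c) set"
  where "coalgebra_auto K C =
    {f \<in> linear_maps K C C \<inter> Bij (carrier C).
      \<forall>c \<in> carrier C. comult C (f c) = tensor_map K C C f f (comult C c) \<and>
                      counit C (f c) = counit C c}"

definition coalgebra_AutoGroup ::
  "('k, 'r) ring_scheme \<Rightarrow> ('k, 'c, 'm) coalgebra_scheme \<Rightarrow> ('c \<Rightarrow> 'c) monoid"
  where "coalgebra_AutoGroup K C = BijGroup (carrier C) \<lparr>carrier := coalgebra_auto K C\<rparr>"

text \<open>The restriction of \<open>f\<close> to the grouplike elements, read as a permutation of \<open>V\<close> via a
  bijection \<open>\<gamma>\<close> from \<open>V\<close> onto the grouplike elements.\<close>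

definition grouplike_restriction ::
  "('k, 'r) ring_scheme \<Rightarrow> ('k, 'c, 'm) coalgebra_scheme \<Rightarrow> 'v set \<Rightarrow> ('v \<Rightarrow> 'c) \<Rightarrow>
   ('c \<Rightarrow> 'c) \<Rightarrow> 'v \<Rightarrow> 'v"
  where "grouplike_restriction K C V \<gamma> f =
    (\<lambda>v\<in>V. inv_into V \<gamma> (restrict f (grouplikes K C) (\<gamma> v)))"


section \<open>Groups\<close>

definition digraph_auto :: "'v pair_pre_digraph \<Rightarrow> ('v \<Rightarrow> 'v) set"
  where "digraph_auto G =
    {\<sigma> \<in> Bij (pverts G).
      \<forall>v \<in> pverts G. \<forall>w \<in> pverts G. (v, w) \<in> parcs G \<longleftrightarrow> (\<sigma> v, \<sigma> w) \<in> parcs G}"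

definition digraph_AutoGroup :: "'v pair_pre_digraph \<Rightarrow> ('v \<Rightarrow> 'v) monoid"
  where "digraph_AutoGroup G = BijGroup (pverts G) \<lparr>carrier := digraph_auto G\<rparr>"

definition semidirect_product ::
  "('n, 'a) monoid_scheme \<Rightarrow> ('h, 'b) monoid_scheme \<Rightarrow> ('h \<Rightarrow> 'n \<Rightarrow> 'n) \<Rightarrow> ('n \<times> 'h) monoid"
  where "semidirect_product N H \<theta> =
    \<lparr>carrier = carrier N \<times> carrier H,
     monoid.mult = (\<lambda>(n, h) (n', h'). (n \<otimes>\<^bsub>N\<^esub> \<theta> h n', h \<otimes>\<^bsub>H\<^esub> h')),
     one = (\<one>\<^bsub>N\<^esub>, \<one>\<^bsub>H\<^esub>)\<rparr>"

definition affine_group :: "('k, 'r) ring_scheme \<Rightarrow> ('k \<times> 'k) monoid"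
  where "affine_group K = semidirect_product (add_monoid K) (mult_of K) (\<lambda>a b. a \<otimes>\<^bsub>K\<^esub> b)"

text \<open>\<^const>\<open>short_exact_sequence\<close> requires all groups to have elements of the same type; the
  formulation below follows its characterisation \<open>short_exact_sequence_iff\<close>.\<close>

definition split_short_exact ::
  "('n, 'a) monoid_scheme \<Rightarrow> ('g, 'b) monoid_scheme \<Rightarrow> ('h, 'c) monoid_scheme \<Rightarrow>
   ('n \<Rightarrow> 'g) \<Rightarrow> ('g \<Rightarrow> 'h) \<Rightarrow> bool"
  where "split_short_exact N G H i p \<longleftrightarrow>
    group N \<and> group G \<and> group H \<and>
    i \<in> mon N G \<and> p \<in> epi G H \<and> i ` carrier N = kernel G H p \<and>
    (\<exists>s \<in> hom H G. \<forall>h \<in> carrier H. p (s h) = h)"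

end

theory Submission
  imports Defs
begin

text \<open>The coalgebra is spanned by the vertices and the arcs, with
  \<open>\<Delta> v = v \<otimes> v\<close> and \<open>\<Delta> e = v \<otimes> e + e \<otimes> w\<close> for an arc \<open>e\<close> from \<open>v\<close> to \<open>w\<close>, and by one further
  element over each loop.  Its grouplike elements are the vertices, and the space of
  \<open>(v, w)\<close>-skew-primitive elements is spanned by \<open>v - w\<close> and by the arc from \<open>v\<close> to \<open>w\<close>, if there is
  one.  Hence an automorphism permutes the vertices, this permutation preserves the arcs, and if it is
  trivial then an arc \<open>e\<close> with distinct ends is sent to \<open>a e + b (v - w)\<close> with \<open>a \<noteq> 0\<close>, while
  the extra elements provide the second parameter for the loops; all these parameters can be
  prescribed independently.  The splitting permutes the basis.\<close>

section \<open>Linear maps\<close>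

text \<open>Everything about \<open>C\<close> rests on reading its comultiplication in coordinates:
  pairing \<open>comult C u\<close> with the coordinates of two basis paths gives the value of
  \<open>u\<close> at their composite, or zero (\<open>coeff_comult\<close>). A grouplike element is
  therefore a function that is multiplicative on paths, and the equations for images of arcs and
  loops become scalar equations, one for each pair of basis paths; no basis of the tensor product is
  ever needed. Arcs and loops share the parameter \<open>(n, h)\<close>. Put
  \<open>a = h^{-1}\<close>. An arc with distinct ends goes to
  \<open>a ([v, w] + n ([v] - [w]))\<close>. Over a loop the automorphisms are dual to the
  substitutions \<open>x -> a x + b x^2\<close> in \<open>K[x]/(x^3)\<close>, so
  \<open>[v, v]\<close> goes to \<open>a [v, v]\<close> and \<open>[v, v, v]\<close> to
  \<open>a^2 [v, v, v] + b [v, v]\<close>; the normalisation \<open>b = a^2 n\<close> makes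
  composition follow the law \<open>(n + h n', h h')\<close> in both cases.\<close>

lemma linear_mapsI:
  assumes "\<And>x. x \<in> carrier M \<Longrightarrow> f x \<in> carrier N"
    and "\<And>x y. x \<in> carrier M \<Longrightarrow> y \<in> carrier M \<Longrightarrow> f (x \<oplus>\<^bsub>M\<^esub> y) = f x \<oplus>\<^bsub>N\<^esub> f y"
    and "\<And>a x. a \<in> carrier K \<Longrightarrow> x \<in> carrier M \<Longrightarrow> f (a \<odot>\<^bsub>M\<^esub> x) = a \<odot>\<^bsub>N\<^esub> f x"
  shows "f \<in> linear_maps K M N"
  using assms by (auto simp: linear_maps_def)

lemma linear_maps_closed: "f \<in> linear_maps K M N \<Longrightarrow> x \<in> carrier M \<Longrightarrow> f x \<in> carrier N"
  by (auto simp: linear_maps_def)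

lemma linear_maps_add:
  "f \<in> linear_maps K M N \<Longrightarrow> x \<in> carrier M \<Longrightarrow> y \<in> carrier M \<Longrightarrow> f (x \<oplus>\<^bsub>M\<^esub> y) = f x \<oplus>\<^bsub>N\<^esub> f y"
  by (auto simp: linear_maps_def)

lemma linear_maps_smult:
  "f \<in> linear_maps K M N \<Longrightarrow> a \<in> carrier K \<Longrightarrow> x \<in> carrier M \<Longrightarrow> f (a \<odot>\<^bsub>M\<^esub> x) = a \<odot>\<^bsub>N\<^esub> f x"
  by (auto simp: linear_maps_def)

lemma linear_maps_zero:
  assumes "module K M" "module K N" "f \<in> linear_maps K M N"
  shows "f \<zero>\<^bsub>M\<^esub> = \<zero>\<^bsub>N\<^esub>"
proof -
  interpret M: module K M by fact
  interpret N: module K N by fact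
  have "f (\<zero>\<^bsub>K\<^esub> \<odot>\<^bsub>M\<^esub> \<zero>\<^bsub>M\<^esub>) = \<zero>\<^bsub>K\<^esub> \<odot>\<^bsub>N\<^esub> f \<zero>\<^bsub>M\<^esub>"
    by (rule linear_maps_smult[OF assms(3)]) simp_all
  then show ?thesis
    using linear_maps_closed[OF assms(3)] by simp
qed

lemma linear_maps_comp:
  assumes "f \<in> linear_maps K L M" "g \<in> linear_maps K M N"
  shows "(\<lambda>x. g (f x)) \<in> linear_maps K L N"
  using assms by (auto simp: linear_maps_def Pi_iff)

lemma linear_maps_id: "(\<lambda>x. x) \<in> linear_maps K M M"
  by (auto simp: linear_maps_def)

lemma linear_maps_plus:
  assumes "module K M" "module K N" "f \<in> linear_maps K M N" "g \<in> linear_maps K M N"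
  shows "(\<lambda>x. f x \<oplus>\<^bsub>N\<^esub> g x) \<in> linear_maps K M N"
proof -
  interpret N: module K N by fact
  show ?thesis using assms(3,4)
    by (auto simp: linear_maps_def Pi_iff N.smult_r_distr N.M.a_ac)
qed

lemma linear_maps_scale:
  assumes "module K M" "module K N" "f \<in> linear_maps K M N" "a \<in> carrier K"
  shows "(\<lambda>x. a \<odot>\<^bsub>N\<^esub> f x) \<in> linear_maps K M N"
proof -
  interpret N: module K N by fact
  have "a \<odot>\<^bsub>N\<^esub> (b \<odot>\<^bsub>N\<^esub> x) = b \<odot>\<^bsub>N\<^esub> (a \<odot>\<^bsub>N\<^esub> x)" if "b \<in> carrier K" "x \<in> carrier N" for b x
    using that assms(4) by (simp flip: N.smult_assoc1 add: N.R.m_comm)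
  then show ?thesis using assms(3,4)
    by (auto simp: linear_maps_def Pi_iff N.smult_r_distr)
qed

lemma linear_maps_cong:
  assumes "module K M" "f \<in> linear_maps K M N" "\<And>x. x \<in> carrier M \<Longrightarrow> g x = f x"
  shows "g \<in> linear_maps K M N"
proof -
  interpret M: module K M by fact
  show ?thesis using assms(2,3) by (auto simp: linear_maps_def Pi_iff)
qed

lemma module_smult_minus_one:
  assumes "module K M" "x \<in> carrier M"
  shows "\<ominus>\<^bsub>M\<^esub> x = (\<ominus>\<^bsub>K\<^esub> \<one>\<^bsub>K\<^esub>) \<odot>\<^bsub>M\<^esub> x"
proof -
  interpret M: module K M by fact
  show ?thesis using assms(2) by (simp add: M.smult_l_minus)
qed

lemma linear_maps_minus:
  assumes "module K M" "module K N" "f \<in> linear_maps K M N" "x \<in> carrier M" "y \<in> carrier M"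
  shows "f (x \<ominus>\<^bsub>M\<^esub> y) = f x \<ominus>\<^bsub>N\<^esub> f y"
proof -
  interpret M: module K M by fact
  interpret N: module K N by fact
  show ?thesis using assms
    by (simp add: a_minus_def module_smult_minus_one linear_maps_add linear_maps_smult linear_maps_closed)
qed

lemma submodule_kernel:
  assumes "module K M" "module K N" "f \<in> linear_maps K M N"
  shows "submodule {x \<in> carrier M. f x = \<zero>\<^bsub>N\<^esub>} K M"
proof -
  interpret M: module K M by fact
  interpret N: module K N by fact
  show ?thesis
    by (rule M.submoduleI)
      (auto simp: module_smult_minus_one[OF assms(1)] linear_maps_zero[OF assms]
        linear_maps_add[OF assms(3)] linear_maps_smult[OF assms(3)])
qed


section \<open>The ground field and free modules\<close>

lemma regular_module_simps [simp]:
  "carrier (regular_module K) = carrier K" "\<zero>\<^bsub>regular_module K\<^esub> = \<zero>\<^bsub>K\<^esub>"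
  "ring.add (regular_module K) = ring.add K" "smult (regular_module K) = monoid.mult K"
  by (simp_all add: regular_module_def)

lemma module_regular_module:
  assumes "cring K" shows "module K (regular_module K)"
proof -
  interpret cring K by fact
  show ?thesis
    by (intro moduleI abelian_groupI assms)
      (auto simp: l_distr r_distr m_assoc a_ac intro: a_inv_closed l_neg)
qed

lemma free_module_simps [simp]:
  "carrier (free_module K B) =
    {u \<in> UNIV \<rightarrow> carrier K. finite {x. u x \<noteq> \<zero>\<^bsub>K\<^esub>} \<and> (\<forall>x. x \<notin> B \<longrightarrow> u x = \<zero>\<^bsub>K\<^esub>)}"
  "\<zero>\<^bsub>free_module K B\<^esub> = (\<lambda>x. \<zero>\<^bsub>K\<^esub>)"
  "ring.add (free_module K B) = (\<lambda>u w x. u x \<oplus>\<^bsub>K\<^esub> w x)"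
  "smult (free_module K B) = (\<lambda>a u x. a \<otimes>\<^bsub>K\<^esub> u x)"
  by (simp_all add: free_module_def)

lemma module_free_module:
  assumes "cring K" shows "module K (free_module K B)"
proof -
  interpret cring K by fact
  have add: "finite {x. u x \<oplus>\<^bsub>K\<^esub> w x \<noteq> \<zero>\<^bsub>K\<^esub>}"
    if "finite {x. u x \<noteq> \<zero>\<^bsub>K\<^esub>}" "finite {x. w x \<noteq> \<zero>\<^bsub>K\<^esub>}" for u w :: "'c \<Rightarrow> 'a"
    by (rule finite_subset[OF _ finite_UnI[OF that]]) auto
  have smult: "finite {x. a \<otimes>\<^bsub>K\<^esub> u x \<noteq> \<zero>\<^bsub>K\<^esub>}"
    if "finite {x. u x \<noteq> \<zero>\<^bsub>K\<^esub>}" "a \<in> carrier K" for a and u :: "'c \<Rightarrow> 'a"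
    by (rule finite_subset[OF _ that(1)]) (use that(2) in auto)
  \<comment> \<open>The negative is taken as \<open>-1\<close> times \<open>u\<close>, because
    finiteness of its support is then an instance of \<open>smult\<close>.\<close>
  have inv: "\<exists>w\<in>carrier (free_module K B). w \<oplus>\<^bsub>free_module K B\<^esub> u = \<zero>\<^bsub>free_module K B\<^esub>"
    if "u \<in> carrier (free_module K B)" for u
    by (rule bexI[of _ "(\<ominus>\<^bsub>K\<^esub> \<one>\<^bsub>K\<^esub>) \<odot>\<^bsub>free_module K B\<^esub> u"])
      (use that in \<open>auto simp: Pi_iff smult l_minus l_neg\<close>)
  show ?thesis
    by (intro moduleI abelian_groupI assms inv)
      (auto simp: Pi_iff fun_eq_iff add smult l_distr r_distr m_assoc a_assoc intro: a_comm)
qed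

lemma free_gen_closed:
  assumes "cring K" "b \<in> B" shows "free_gen K b \<in> carrier (free_module K B)"
proof -
  interpret cring K by fact
  have "finite {x. free_gen K b x \<noteq> \<zero>\<^bsub>K\<^esub>}"
    by (rule finite_subset[of _ "{b}"]) (auto simp: free_gen_def)
  then show ?thesis using assms(2) by (auto simp: free_gen_def)
qed

text \<open>The sum has the shape of the body of \<open>tensor_lift\<close>, so that
  \<open>tensor_lift\<close> at a coset is \<open>free_lift\<close> at the chosen
  representative.\<close>

definition free_lift ::
  "('k, 'r) ring_scheme \<Rightarrow> ('k, 'p, 'q) module_scheme \<Rightarrow> ('x \<Rightarrow> 'p) \<Rightarrow> ('x \<Rightarrow> 'k) \<Rightarrow> 'p"
  where "free_lift K P g u = (\<Oplus>\<^bsub>P\<^esub>b \<in> {b. u b \<noteq> \<zero>\<^bsub>K\<^esub>}. u b \<odot>\<^bsub>P\<^esub> g b)"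

text \<open>The support varies with the vector; summing over any finite set containing it lets two
  vectors and their sum share one index set, which is what additivity of \<open>free_lift\<close>
  needs.\<close>

lemma free_lift_eq_finsum:
  assumes "module K P" "g \<in> B \<rightarrow> carrier P" "u \<in> carrier (free_module K B)"
    and "finite A" "A \<subseteq> B" "{b. u b \<noteq> \<zero>\<^bsub>K\<^esub>} \<subseteq> A"
  shows "free_lift K P g u = (\<Oplus>\<^bsub>P\<^esub>b \<in> A. u b \<odot>\<^bsub>P\<^esub> g b)"
proof -
  interpret P: module K P by fact
  show ?thesis unfolding free_lift_def
    by (rule P.M.add.finprod_mono_neutral_cong_left)
      (use assms(2-) in \<open>auto simp: Pi_iff subset_iff\<close>)
qed

lemma free_lift_linear:
  assumes "module K P" "g \<in> B \<rightarrow> carrier P"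
  shows "free_lift K P g \<in> linear_maps K (free_module K B) P"
proof -
  interpret P: module K P by fact
  interpret F: module K "free_module K B" by (rule module_free_module) (rule P.R.is_cring)
  have supp: "\<exists>A. finite A \<and> A \<subseteq> B \<and> {b. u b \<noteq> \<zero>\<^bsub>K\<^esub>} \<subseteq> A \<and> {b. w b \<noteq> \<zero>\<^bsub>K\<^esub>} \<subseteq> A"
    if "u \<in> carrier (free_module K B)" "w \<in> carrier (free_module K B)" for u w
    by (rule exI[of _ "{b. u b \<noteq> \<zero>\<^bsub>K\<^esub>} \<union> {b. w b \<noteq> \<zero>\<^bsub>K\<^esub>}"]) (use that in auto)
  show ?thesis
  proof (rule linear_mapsI)
    fix u assume u: "u \<in> carrier (free_module K B)"
    then show "free_lift K P g u \<in> carrier P"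
      unfolding free_lift_def by (intro P.M.finsum_closed) (use assms(2) in \<open>auto simp: Pi_iff\<close>)
  next
    fix u w assume u: "u \<in> carrier (free_module K B)" and w: "w \<in> carrier (free_module K B)"
    obtain A where A: "finite A" "A \<subseteq> B" "{b. u b \<noteq> \<zero>\<^bsub>K\<^esub>} \<subseteq> A" "{b. w b \<noteq> \<zero>\<^bsub>K\<^esub>} \<subseteq> A"
      using supp[OF u w] by blast
    have "u b = \<zero>\<^bsub>K\<^esub>" "w b = \<zero>\<^bsub>K\<^esub>" if "b \<notin> A" for b using that A by auto
    then have A': "{b. (u \<oplus>\<^bsub>free_module K B\<^esub> w) b \<noteq> \<zero>\<^bsub>K\<^esub>} \<subseteq> A" by force
    have cl: "u b \<in> carrier K" "w b \<in> carrier K" for b using u w by auto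
    have g: "g b \<in> carrier P" if "b \<in> A" for b using that A assms(2) by auto
    have "free_lift K P g (u \<oplus>\<^bsub>free_module K B\<^esub> w)
        = (\<Oplus>\<^bsub>P\<^esub>b \<in> A. (u \<oplus>\<^bsub>free_module K B\<^esub> w) b \<odot>\<^bsub>P\<^esub> g b)"
      by (rule free_lift_eq_finsum[OF assms F.M.a_closed[OF u w] A(1,2) A'])
    also have "\<dots> = (\<Oplus>\<^bsub>P\<^esub>b \<in> A. u b \<odot>\<^bsub>P\<^esub> g b \<oplus>\<^bsub>P\<^esub> w b \<odot>\<^bsub>P\<^esub> g b)"
      by (rule P.M.finsum_cong') (auto simp: P.smult_l_distr cl g)
    also have "\<dots> = (\<Oplus>\<^bsub>P\<^esub>b \<in> A. u b \<odot>\<^bsub>P\<^esub> g b) \<oplus>\<^bsub>P\<^esub> (\<Oplus>\<^bsub>P\<^esub>b \<in> A. w b \<odot>\<^bsub>P\<^esub> g b)"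
      by (rule P.M.finsum_addf) (auto simp: cl g)
    also have "\<dots> = free_lift K P g u \<oplus>\<^bsub>P\<^esub> free_lift K P g w"
      using free_lift_eq_finsum[OF assms u A(1,2,3)] free_lift_eq_finsum[OF assms w A(1,2,4)]
      by simp
    finally show "free_lift K P g (u \<oplus>\<^bsub>free_module K B\<^esub> w) =
      free_lift K P g u \<oplus>\<^bsub>P\<^esub> free_lift K P g w" .
  next
    fix a u assume a: "a \<in> carrier K" and u: "u \<in> carrier (free_module K B)"
    obtain A where A: "finite A" "A \<subseteq> B" "{b. u b \<noteq> \<zero>\<^bsub>K\<^esub>} \<subseteq> A"
      using supp[OF u u] by blast
    then have A': "{b. (a \<odot>\<^bsub>free_module K B\<^esub> u) b \<noteq> \<zero>\<^bsub>K\<^esub>} \<subseteq> A" using a by auto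
    have cl: "u b \<in> carrier K" for b using u by auto
    have g: "g b \<in> carrier P" if "b \<in> A" for b using that A assms(2) by auto
    have "free_lift K P g (a \<odot>\<^bsub>free_module K B\<^esub> u)
        = (\<Oplus>\<^bsub>P\<^esub>b \<in> A. (a \<odot>\<^bsub>free_module K B\<^esub> u) b \<odot>\<^bsub>P\<^esub> g b)"
      by (rule free_lift_eq_finsum[OF assms F.smult_closed[OF a u] A(1,2) A'])
    also have "\<dots> = (\<Oplus>\<^bsub>P\<^esub>b \<in> A. a \<odot>\<^bsub>P\<^esub> (u b \<odot>\<^bsub>P\<^esub> g b))"
      by (rule P.M.finsum_cong') (auto simp: P.smult_assoc1 cl g a)
    also have "\<dots> = a \<odot>\<^bsub>P\<^esub> (\<Oplus>\<^bsub>P\<^esub>b \<in> A. u b \<odot>\<^bsub>P\<^esub> g b)"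
      by (rule P.finsum_smult_ldistr[symmetric]) (auto simp: cl g a A)
    also have "\<dots> = a \<odot>\<^bsub>P\<^esub> free_lift K P g u"
      using free_lift_eq_finsum[OF assms u A] by simp
    finally show "free_lift K P g (a \<odot>\<^bsub>free_module K B\<^esub> u) = a \<odot>\<^bsub>P\<^esub> free_lift K P g u" .
  qed
qed

lemma free_lift_gen:
  assumes "module K P" "g \<in> B \<rightarrow> carrier P" "b \<in> B"
  shows "free_lift K P g (free_gen K b) = g b"
proof -
  interpret P: module K P by fact
  have "free_lift K P g (free_gen K b) = (\<Oplus>\<^bsub>P\<^esub>x \<in> {b}. free_gen K b x \<odot>\<^bsub>P\<^esub> g x)"
    by (rule free_lift_eq_finsum[OF assms(1,2)])
      (use assms(3) free_gen_closed[OF P.R.is_cring assms(3)] in \<open>auto simp: free_gen_def\<close>)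
  also have "\<dots> = g b"
    using assms(2,3) by (subst P.M.finsum_insert) (auto simp: free_gen_def Pi_iff)
  finally show ?thesis .
qed

lemma linear_maps_free_module_eqI:
  assumes "module K P"
    and f: "f \<in> linear_maps K (free_module K B) P" and f': "f' \<in> linear_maps K (free_module K B) P"
    and eq: "\<And>b. b \<in> B \<Longrightarrow> f (free_gen K b) = f' (free_gen K b)"
    and "u \<in> carrier (free_module K B)"
  shows "f u = f' u"
proof -
  interpret P: module K P by fact
  let ?F = "free_module K B"
  interpret F: module K ?F by (rule module_free_module) (rule P.R.is_cring)
  \<comment> \<open>The induction runs over a finite set that contains the support, not over the
    support itself: setting the coordinate at \<open>b\<close> to zero then stays within the smaller
    set.\<close>
  have "f u = f' u" if "finite A" "A \<subseteq> B" "u \<in> carrier ?F" "{x. u x \<noteq> \<zero>\<^bsub>K\<^esub>} \<subseteq> A" for A u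
    using that
  proof (induction A arbitrary: u)
    case empty
    then have "u = \<zero>\<^bsub>?F\<^esub>" by auto
    then show ?case
      using linear_maps_zero[OF F.module_axioms assms(1)] f f' by metis
  next
    case (insert b A)
    let ?w = "u(b := \<zero>\<^bsub>K\<^esub>)" and ?g = "free_gen K b"
    have b: "b \<in> B" using insert by auto
    have "{x. ?w x \<noteq> \<zero>\<^bsub>K\<^esub>} \<subseteq> {x. u x \<noteq> \<zero>\<^bsub>K\<^esub>}" by auto
    then have w: "?w \<in> carrier ?F"
      using insert.prems(2) by (auto simp: Pi_iff intro: finite_subset)
    have ub: "u b \<in> carrier K" using insert.prems(2) by auto
    have g: "?g \<in> carrier ?F" by (rule free_gen_closed[OF P.R.is_cring b])
    have bg: "u b \<odot>\<^bsub>?F\<^esub> ?g \<in> carrier ?F" by (rule F.smult_closed[OF ub g])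
    have u: "u = ?w \<oplus>\<^bsub>?F\<^esub> u b \<odot>\<^bsub>?F\<^esub> ?g"
      using insert.prems(2) by (auto simp: fun_eq_iff free_gen_def Pi_iff)
    have "f ?w = f' ?w"
      by (rule insert.IH[OF _ w]) (use insert.prems in auto)
    then have "f (?w \<oplus>\<^bsub>?F\<^esub> u b \<odot>\<^bsub>?F\<^esub> ?g) = f' (?w \<oplus>\<^bsub>?F\<^esub> u b \<odot>\<^bsub>?F\<^esub> ?g)"
      unfolding linear_maps_add[OF f w bg] linear_maps_add[OF f' w bg]
        linear_maps_smult[OF f ub g] linear_maps_smult[OF f' ub g] eq[OF b] by simp
    then show ?case using u by simp
  qed
  from this[of "{x. u x \<noteq> \<zero>\<^bsub>K\<^esub>}"] show ?thesis using assms(5) by auto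
qed

section \<open>Quotient modules\<close>

lemma module_quotient_module:
  assumes "module K M" "submodule S K M"
  shows "module K (quotient_module M S)"
    and "(\<lambda>x. S +>\<^bsub>M\<^esub> x) \<in> linear_maps K M (quotient_module M S)"
proof -
  interpret M: module K M by fact
  interpret S: submodule S K M by fact
  interpret S: abelian_subgroup S M
    by (rule abelian_subgroupI3) (use S.subgroup_axioms M.M.abelian_group_axioms in
      \<open>auto intro: additive_subgroupI\<close>)
  let ?Q = "quotient_module M S"
  have carr: "A \<in> carrier ?Q \<longleftrightarrow> (\<exists>x\<in>carrier M. A = S +>\<^bsub>M\<^esub> x)" for A
    by (auto simp: quotient_module_def A_RCOSETS_def')
  have add: "(S +>\<^bsub>M\<^esub> x) \<oplus>\<^bsub>?Q\<^esub> (S +>\<^bsub>M\<^esub> y) = S +>\<^bsub>M\<^esub> (x \<oplus>\<^bsub>M\<^esub> y)"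
    if "x \<in> carrier M" "y \<in> carrier M" for x y
    using that by (simp add: quotient_module_def S.a_rcos_sum)
  have zero: "\<zero>\<^bsub>?Q\<^esub> = S +>\<^bsub>M\<^esub> \<zero>\<^bsub>M\<^esub>"
    by (simp add: quotient_module_def S.a_subset)
  have smult: "a \<odot>\<^bsub>?Q\<^esub> (S +>\<^bsub>M\<^esub> x) = S +>\<^bsub>M\<^esub> (a \<odot>\<^bsub>M\<^esub> x)"
    if a: "a \<in> carrier K" and x: "x \<in> carrier M" for a x
  proof -
    \<comment> \<open>All members of a coset give the same scaled coset, so the union in the
      definition of \<open>smult\<close> is a union of equal sets; it is nonempty because the coset
      contains \<open>x\<close>.\<close>
    have "S +>\<^bsub>M\<^esub> (a \<odot>\<^bsub>M\<^esub> y) = S +>\<^bsub>M\<^esub> (a \<odot>\<^bsub>M\<^esub> x)" if y: "y \<in> S +>\<^bsub>M\<^esub> x" for y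
    proof -
      obtain s where s: "s \<in> S" "y = s \<oplus>\<^bsub>M\<^esub> x"
        using y by (auto simp: a_r_coset_def')
      then have "a \<odot>\<^bsub>M\<^esub> y = a \<odot>\<^bsub>M\<^esub> s \<oplus>\<^bsub>M\<^esub> a \<odot>\<^bsub>M\<^esub> x"
        using a x by (simp add: M.smult_r_distr)
      then have "a \<odot>\<^bsub>M\<^esub> y \<in> S +>\<^bsub>M\<^esub> (a \<odot>\<^bsub>M\<^esub> x)"
        using s a by (auto simp: a_r_coset_def')
      then show ?thesis
        using S.a_repr_independence'[of "a \<odot>\<^bsub>M\<^esub> y" "a \<odot>\<^bsub>M\<^esub> x"] a x by simp
    qed
    moreover have "x \<in> S +>\<^bsub>M\<^esub> x" using S.a_rcos_self[OF x] .
    ultimately have "(\<Union>y\<in>S +>\<^bsub>M\<^esub> x. S +>\<^bsub>M\<^esub> (a \<odot>\<^bsub>M\<^esub> y)) = S +>\<^bsub>M\<^esub> (a \<odot>\<^bsub>M\<^esub> x)"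
      by blast
    then show ?thesis by (simp add: quotient_module_def)
  qed
  have carrE: "\<exists>x\<in>carrier M. A = S +>\<^bsub>M\<^esub> x" if "A \<in> carrier ?Q" for A using that carr by simp
  have carrI: "S +>\<^bsub>M\<^esub> x \<in> carrier ?Q" if "x \<in> carrier M" for x using that carr by blast
  show mod: "module K ?Q"
  proof (intro moduleI abelian_groupI)
    show "cring K" by (rule M.R.is_cring)
    show "\<zero>\<^bsub>?Q\<^esub> \<in> carrier ?Q" by (simp add: zero carrI)
  next
    fix A assume "A \<in> carrier ?Q"
    then obtain x where x: "x \<in> carrier M" "A = S +>\<^bsub>M\<^esub> x" using carrE by blast
    show "\<exists>y\<in>carrier ?Q. y \<oplus>\<^bsub>?Q\<^esub> A = \<zero>\<^bsub>?Q\<^esub>"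
      by (rule bexI[of _ "S +>\<^bsub>M\<^esub> (\<ominus>\<^bsub>M\<^esub> x)"]) (simp_all add: x add zero M.M.l_neg carrI)
    show "\<zero>\<^bsub>?Q\<^esub> \<oplus>\<^bsub>?Q\<^esub> A = A" "\<one>\<^bsub>K\<^esub> \<odot>\<^bsub>?Q\<^esub> A = A"
      by (simp_all add: x add zero smult)
    fix B assume "B \<in> carrier ?Q"
    then obtain y where y: "y \<in> carrier M" "B = S +>\<^bsub>M\<^esub> y" using carrE by blast
    show "A \<oplus>\<^bsub>?Q\<^esub> B \<in> carrier ?Q" "A \<oplus>\<^bsub>?Q\<^esub> B = B \<oplus>\<^bsub>?Q\<^esub> A"
      using x y M.M.a_comm[OF x(1) y(1)] by (simp_all add: add carrI)
    fix D assume "D \<in> carrier ?Q"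
    then obtain z where z: "z \<in> carrier M" "D = S +>\<^bsub>M\<^esub> z" using carrE by blast
    show "A \<oplus>\<^bsub>?Q\<^esub> B \<oplus>\<^bsub>?Q\<^esub> D = A \<oplus>\<^bsub>?Q\<^esub> (B \<oplus>\<^bsub>?Q\<^esub> D)"
      using x y z by (simp add: add M.M.a_assoc)
  next
    fix a A assume a: "a \<in> carrier K" and "A \<in> carrier ?Q"
    then obtain x where x: "x \<in> carrier M" "A = S +>\<^bsub>M\<^esub> x" using carrE by blast
    show "a \<odot>\<^bsub>?Q\<^esub> A \<in> carrier ?Q" using a x by (simp add: smult carrI)
    show "(a \<oplus>\<^bsub>K\<^esub> b) \<odot>\<^bsub>?Q\<^esub> A = a \<odot>\<^bsub>?Q\<^esub> A \<oplus>\<^bsub>?Q\<^esub> b \<odot>\<^bsub>?Q\<^esub> A"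
      "(a \<otimes>\<^bsub>K\<^esub> b) \<odot>\<^bsub>?Q\<^esub> A = a \<odot>\<^bsub>?Q\<^esub> (b \<odot>\<^bsub>?Q\<^esub> A)" if "b \<in> carrier K" for b
      using a x that by (simp_all add: add smult M.smult_l_distr M.smult_assoc1)
    fix B assume "B \<in> carrier ?Q"
    then obtain y where y: "y \<in> carrier M" "B = S +>\<^bsub>M\<^esub> y" using carrE by blast
    show "a \<odot>\<^bsub>?Q\<^esub> (A \<oplus>\<^bsub>?Q\<^esub> B) = a \<odot>\<^bsub>?Q\<^esub> A \<oplus>\<^bsub>?Q\<^esub> a \<odot>\<^bsub>?Q\<^esub> B"
      using a x y by (simp add: add smult M.smult_r_distr)
  qed
  show "(\<lambda>x. S +>\<^bsub>M\<^esub> x) \<in> linear_maps K M ?Q"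
    by (rule linear_mapsI) (simp_all add: carrI add smult)
qed

lemma quotient_module_carrier:
  "carrier (quotient_module M S) = (\<lambda>x. S +>\<^bsub>M\<^esub> x) ` carrier M"
  by (auto simp: quotient_module_def A_RCOSETS_def')

lemma quotient_module_coset_eq:
  assumes "module K M" "submodule S K M" "s \<in> S" "x \<in> carrier M"
  shows "S +>\<^bsub>M\<^esub> (s \<oplus>\<^bsub>M\<^esub> x) = S +>\<^bsub>M\<^esub> x"
proof -
  interpret M: module K M by fact
  interpret S: submodule S K M by fact
  interpret S: abelian_subgroup S M
    by (rule abelian_subgroupI3) (use S.subgroup_axioms M.M.abelian_group_axioms in
      \<open>auto intro: additive_subgroupI\<close>)
  show ?thesis
    using assms(3,4) by (intro S.a_repr_independence'[symmetric]) (auto simp: a_r_coset_def')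
qed

section \<open>Universal property of the tensor product\<close>

lemma submodule_generated_submodule:
  assumes "module K M" "A \<subseteq> carrier M"
  shows "submodule (generated_submodule K M A) K M"
proof -
  interpret M: module K M by fact
  let ?\<S> = "{S. submodule S K M \<and> A \<subseteq> S}"
  \<comment> \<open>\<open>carrier M\<close> belongs to the family, so the intersection is not over
    the empty family and stays inside \<open>carrier M\<close>.\<close>
  have C: "carrier M \<in> ?\<S>" using assms(2) M.carrier_is_submodule by auto
  have zero: "\<zero>\<^bsub>M\<^esub> \<in> S" if "S \<in> ?\<S>" for S
    using that subgroup.one_closed[of S "add_monoid M"] by (auto simp: submodule_def)
  show ?thesis unfolding generated_submodule_def
  proof (rule M.submoduleI)
    show "\<Inter>?\<S> \<subseteq> carrier M" using C by blast
    show "\<zero>\<^bsub>M\<^esub> \<in> \<Inter>?\<S>" using zero by blast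
    show "\<ominus>\<^bsub>M\<^esub> a \<in> \<Inter>?\<S>" if "a \<in> \<Inter>?\<S>" for a
      using that M.submoduleE(3) by blast
    show "a \<oplus>\<^bsub>M\<^esub> b \<in> \<Inter>?\<S>" if "a \<in> \<Inter>?\<S>" "b \<in> \<Inter>?\<S>" for a b
      using that M.submoduleE(5) by blast
    show "a \<odot>\<^bsub>M\<^esub> x \<in> \<Inter>?\<S>" if "a \<in> carrier K" "x \<in> \<Inter>?\<S>" for a x
      using that M.submoduleE(4) by blast
  qed
qed

section \<open>Bilinear maps and the linear maps that they induce\<close>

definition bilinear_maps ::
  "('k, 'r) ring_scheme \<Rightarrow> ('k, 'a, 'm) module_scheme \<Rightarrow> ('k, 'b, 'n) module_scheme \<Rightarrow>
   ('k, 'p, 'q) module_scheme \<Rightarrow> ('a \<Rightarrow> 'b \<Rightarrow> 'p) set"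
  where "bilinear_maps K M N P =
    {\<beta>. (\<forall>y \<in> carrier N. (\<lambda>x. \<beta> x y) \<in> linear_maps K M P) \<and>
        (\<forall>x \<in> carrier M. (\<lambda>y. \<beta> x y) \<in> linear_maps K N P)}"

lemma bilinear_mapsI:
  assumes "\<And>y. y \<in> carrier N \<Longrightarrow> (\<lambda>x. \<beta> x y) \<in> linear_maps K M P"
    and "\<And>x. x \<in> carrier M \<Longrightarrow> (\<lambda>y. \<beta> x y) \<in> linear_maps K N P"
  shows "\<beta> \<in> bilinear_maps K M N P"
  using assms by (simp add: bilinear_maps_def)

lemma bilinear_maps_left:
  "\<beta> \<in> bilinear_maps K M N P \<Longrightarrow> y \<in> carrier N \<Longrightarrow> (\<lambda>x. \<beta> x y) \<in> linear_maps K M P"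
  by (simp add: bilinear_maps_def)

lemma bilinear_maps_right:
  "\<beta> \<in> bilinear_maps K M N P \<Longrightarrow> x \<in> carrier M \<Longrightarrow> (\<lambda>y. \<beta> x y) \<in> linear_maps K N P"
  by (simp add: bilinear_maps_def)

context
  fixes K :: "('k, 'r) ring_scheme"
    and M :: "('k, 'a, 'm) module_scheme" and N :: "('k, 'b, 'n) module_scheme"
  assumes M: "module K M" and N: "module K N"
begin

interpretation M: module K M by (rule M)
interpretation N: module K N by (rule N)

private abbreviation (input) "F \<equiv> free_module K (carrier M \<times> carrier N)"
private abbreviation (input) "S \<equiv> tensor_kernel K M N"
private abbreviation (input) "gen \<equiv> free_gen K"
private abbreviation (input) "T \<equiv> tensor_product K M N"

interpretation F: module K F by (rule module_free_module) (rule M.R.is_cring)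

private lemma gen_closed: "x \<in> carrier M \<Longrightarrow> y \<in> carrier N \<Longrightarrow> gen (x, y) \<in> carrier F"
  by (rule free_gen_closed[OF M.R.is_cring]) simp

private lemma relations_closed: "tensor_relations K M N \<subseteq> carrier F"
  unfolding tensor_relations_def Let_def
  by (intro Un_least subsetI; elim CollectE exE conjE; hypsubst;
      intro F.M.minus_closed F.M.a_closed F.smult_closed gen_closed M.M.a_closed N.M.a_closed
        M.smult_closed N.smult_closed; assumption)

private lemma submodule_S: "submodule S K F"
  unfolding tensor_kernel_def
  by (rule submodule_generated_submodule[OF F.module_axioms relations_closed])

private lemma relations_S: "r \<in> tensor_relations K M N \<Longrightarrow> r \<in> S"
  by (auto simp: tensor_kernel_def generated_submodule_def)

lemma module_tensor_product: "module K (tensor_product K M N)"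
  unfolding tensor_product_def by (rule module_quotient_module[OF F.module_axioms submodule_S])

private lemma proj_linear: "(\<lambda>u. S +>\<^bsub>F\<^esub> u) \<in> linear_maps K F T"
  unfolding tensor_product_def
  by (rule module_quotient_module[OF F.module_axioms submodule_S])

text \<open>Every tensor relation is a difference \<open>u - w\<close>, so it becomes an equation
  between the cosets of \<open>u\<close> and \<open>w\<close>; this gives the bilinearity laws of
  pure tensors.\<close>

private lemma proj_eqI:
  assumes "u \<in> carrier F" "w \<in> carrier F" "u \<ominus>\<^bsub>F\<^esub> w \<in> tensor_relations K M N"
  shows "S +>\<^bsub>F\<^esub> u = S +>\<^bsub>F\<^esub> w"
proof -
  have "u = (u \<ominus>\<^bsub>F\<^esub> w) \<oplus>\<^bsub>F\<^esub> w"
    unfolding a_minus_def F.M.a_assoc[OF assms(1) F.M.a_inv_closed[OF assms(2)] assms(2)]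
    by (simp only: F.M.l_neg[OF assms(2)] F.M.r_zero[OF assms(1)])
  then show ?thesis
    using quotient_module_coset_eq[OF F.module_axioms submodule_S relations_S[OF assms(3)] assms(2)]
    by metis
qed

private lemma tensor_product_cases:
  assumes "t \<in> carrier T" obtains u where "u \<in> carrier F" "t = S +>\<^bsub>F\<^esub> u"
  using assms unfolding tensor_product_def quotient_module_carrier by blast

lemma pure_tensor_bilinear: "pure_tensor K M N \<in> bilinear_maps K M N (tensor_product K M N)"
proof (rule bilinear_mapsI)
  fix y assume y: "y \<in> carrier N"
  show "(\<lambda>x. pure_tensor K M N x y) \<in> linear_maps K M T"
  proof (rule linear_mapsI)
    fix x assume x: "x \<in> carrier M"
    show "pure_tensor K M N x y \<in> carrier T"
      unfolding pure_tensor_def by (rule linear_maps_closed[OF proj_linear gen_closed[OF x y]])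
    fix x' assume x': "x' \<in> carrier M"
    have "S +>\<^bsub>F\<^esub> gen (x \<oplus>\<^bsub>M\<^esub> x', y) = S +>\<^bsub>F\<^esub> (gen (x, y) \<oplus>\<^bsub>F\<^esub> gen (x', y))"
      by (intro proj_eqI F.M.a_closed gen_closed M.M.a_closed x x' y)
        (unfold tensor_relations_def Let_def, use x x' y in blast)
    then show "pure_tensor K M N (x \<oplus>\<^bsub>M\<^esub> x') y = pure_tensor K M N x y \<oplus>\<^bsub>T\<^esub> pure_tensor K M N x' y"
      unfolding pure_tensor_def
      using linear_maps_add[OF proj_linear gen_closed[OF x y] gen_closed[OF x' y]] by (rule trans)
  next
    fix a x assume a: "a \<in> carrier K" and x: "x \<in> carrier M"
    have "S +>\<^bsub>F\<^esub> gen (a \<odot>\<^bsub>M\<^esub> x, y) = S +>\<^bsub>F\<^esub> (a \<odot>\<^bsub>F\<^esub> gen (x, y))"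
      by (intro proj_eqI F.smult_closed gen_closed M.smult_closed a x y)
        (unfold tensor_relations_def Let_def, use a x y in blast)
    then show "pure_tensor K M N (a \<odot>\<^bsub>M\<^esub> x) y = a \<odot>\<^bsub>T\<^esub> pure_tensor K M N x y"
      unfolding pure_tensor_def
      using linear_maps_smult[OF proj_linear a gen_closed[OF x y]] by (rule trans)
  qed
next
  fix x assume x: "x \<in> carrier M"
  show "(\<lambda>y. pure_tensor K M N x y) \<in> linear_maps K N T"
  proof (rule linear_mapsI)
    fix y assume y: "y \<in> carrier N"
    show "pure_tensor K M N x y \<in> carrier T"
      unfolding pure_tensor_def by (rule linear_maps_closed[OF proj_linear gen_closed[OF x y]])
    fix y' assume y': "y' \<in> carrier N"
    have "S +>\<^bsub>F\<^esub> gen (x, y \<oplus>\<^bsub>N\<^esub> y') = S +>\<^bsub>F\<^esub> (gen (x, y) \<oplus>\<^bsub>F\<^esub> gen (x, y'))"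
      by (intro proj_eqI F.M.a_closed gen_closed N.M.a_closed x y y')
        (unfold tensor_relations_def Let_def, use x y y' in blast)
    then show "pure_tensor K M N x (y \<oplus>\<^bsub>N\<^esub> y') = pure_tensor K M N x y \<oplus>\<^bsub>T\<^esub> pure_tensor K M N x y'"
      unfolding pure_tensor_def
      using linear_maps_add[OF proj_linear gen_closed[OF x y] gen_closed[OF x y']] by (rule trans)
  next
    fix a y assume a: "a \<in> carrier K" and y: "y \<in> carrier N"
    have "S +>\<^bsub>F\<^esub> gen (x, a \<odot>\<^bsub>N\<^esub> y) = S +>\<^bsub>F\<^esub> (a \<odot>\<^bsub>F\<^esub> gen (x, y))"
      by (intro proj_eqI F.smult_closed gen_closed N.smult_closed a x y)
        (unfold tensor_relations_def Let_def, use a x y in blast)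
    then show "pure_tensor K M N x (a \<odot>\<^bsub>N\<^esub> y) = a \<odot>\<^bsub>T\<^esub> pure_tensor K M N x y"
      unfolding pure_tensor_def
      using linear_maps_smult[OF proj_linear a gen_closed[OF x y]] by (rule trans)
  qed
qed

text \<open>Precomposed with the projection from the free module both maps are linear, and the
  generators go to pure tensors. This reduces identities between linear maps on a tensor product to
  pure tensors.\<close>

lemma tensor_product_eqI:
  assumes P: "module K P"
    and f: "f \<in> linear_maps K (tensor_product K M N) P"
    and f': "f' \<in> linear_maps K (tensor_product K M N) P"
    and eq: "\<And>x y. x \<in> carrier M \<Longrightarrow> y \<in> carrier N \<Longrightarrow>
      f (pure_tensor K M N x y) = f' (pure_tensor K M N x y)"
    and t: "t \<in> carrier (tensor_product K M N)"
  shows "f t = f' t"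
proof -
  obtain u where u: "u \<in> carrier F" "t = S +>\<^bsub>F\<^esub> u" using tensor_product_cases[OF t] .
  have "f (S +>\<^bsub>F\<^esub> u) = f' (S +>\<^bsub>F\<^esub> u)"
    by (rule linear_maps_free_module_eqI[OF P linear_maps_comp[OF proj_linear f]
          linear_maps_comp[OF proj_linear f'] _ u(1)])
      (use eq in \<open>auto simp: pure_tensor_def\<close>)
  then show ?thesis using u by simp
qed

context
  fixes P :: "('k, 'p, 'q) module_scheme" and \<beta>
  assumes P: "module K P" and \<beta>: "\<beta> \<in> bilinear_maps K M N P"
begin

interpretation P: module K P by (rule P)

private abbreviation (input) "lift \<equiv> free_lift K P (\<lambda>p. \<beta> (fst p) (snd p))"

private lemma lift_linear: "lift \<in> linear_maps K F P"
  by (rule free_lift_linear[OF P])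
    (auto intro: linear_maps_closed[OF bilinear_maps_left[OF \<beta>]])

private lemma lift_gen: "x \<in> carrier M \<Longrightarrow> y \<in> carrier N \<Longrightarrow> lift (gen (x, y)) = \<beta> x y"
  by (subst free_lift_gen[OF P, where B = "carrier M \<times> carrier N"])
    (auto intro: linear_maps_closed[OF bilinear_maps_left[OF \<beta>]])

private lemma lift_relations:
  assumes "r \<in> tensor_relations K M N" shows "lift r = \<zero>\<^bsub>P\<^esub>"
proof -
  have diff: "lift (u \<ominus>\<^bsub>F\<^esub> w) = \<zero>\<^bsub>P\<^esub>"
    if "u \<in> carrier F" "w \<in> carrier F" "lift u = lift w" for u w
    unfolding linear_maps_minus[OF F.module_axioms P lift_linear that(1,2)] that(3)
    by (rule P.M.r_neg[folded a_minus_def]) (rule linear_maps_closed[OF lift_linear that(2)])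
  note lin = linear_maps_add[OF lift_linear gen_closed gen_closed]
    linear_maps_smult[OF lift_linear _ gen_closed]
    linear_maps_add[OF bilinear_maps_left[OF \<beta>]] linear_maps_smult[OF bilinear_maps_left[OF \<beta>]]
    linear_maps_add[OF bilinear_maps_right[OF \<beta>]] linear_maps_smult[OF bilinear_maps_right[OF \<beta>]]
    lift_gen
  show ?thesis
    using assms unfolding tensor_relations_def Let_def
    by (elim UnE CollectE exE conjE; hypsubst;
        intro diff F.M.a_closed F.smult_closed gen_closed M.M.a_closed N.M.a_closed
          M.smult_closed N.smult_closed; (assumption | simp only: lin M.M.a_closed N.M.a_closed
          M.smult_closed N.smult_closed))
qed

text \<open>The choice of a representative in \<open>tensor_lift\<close> does no harm: the vectors
  killed by \<open>lift\<close> form a submodule that contains all relations, hence contains the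
  kernel \<open>S\<close>, and so \<open>lift\<close> is constant on each coset.\<close>

private lemma tensor_lift_coset:
  assumes "u \<in> carrier F" shows "tensor_lift K P \<beta> (S +>\<^bsub>F\<^esub> u) = lift u"
proof -
  have S: "S \<subseteq> {u \<in> carrier F. lift u = \<zero>\<^bsub>P\<^esub>}"
    unfolding tensor_kernel_def generated_submodule_def
    by (rule Inter_lower)
      (use submodule_kernel[OF F.module_axioms P lift_linear] relations_closed lift_relations
       in blast)
  have eq: "lift w = lift u" if w: "w \<in> S +>\<^bsub>F\<^esub> u" for w
  proof -
    obtain s where s: "s \<in> S" "w = s \<oplus>\<^bsub>F\<^esub> u" using w unfolding a_r_coset_def' by blast
    then have s': "s \<in> carrier F" "lift s = \<zero>\<^bsub>P\<^esub>" using S by blast+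
    show ?thesis
      unfolding s(2) linear_maps_add[OF lift_linear s'(1) assms] s'(2)
      by (rule P.M.l_zero[OF linear_maps_closed[OF lift_linear assms]])
  qed
  have "\<zero>\<^bsub>F\<^esub> \<in> S"
    using subgroup.one_closed[OF submodule.axioms(1)[OF submodule_S]]
    by (simp only: monoid.select_convs)
  then have "\<zero>\<^bsub>F\<^esub> \<oplus>\<^bsub>F\<^esub> u \<in> S +>\<^bsub>F\<^esub> u" unfolding a_r_coset_def' by blast
  then have "(SOME w. w \<in> S +>\<^bsub>F\<^esub> u) \<in> S +>\<^bsub>F\<^esub> u"
    by (rule someI[where P = "\<lambda>w. w \<in> S +>\<^bsub>F\<^esub> u"])
  from eq[OF this] show ?thesis unfolding tensor_lift_def free_lift_def Let_def .
qed

lemma tensor_lift_pure: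
  assumes "x \<in> carrier M" "y \<in> carrier N"
  shows "tensor_lift K P \<beta> (pure_tensor K M N x y) = \<beta> x y"
  unfolding pure_tensor_def tensor_lift_coset[OF gen_closed[OF assms]] lift_gen[OF assms] ..

lemma tensor_lift_linear: "tensor_lift K P \<beta> \<in> linear_maps K (tensor_product K M N) P"
proof (rule linear_mapsI)
  fix t assume t: "t \<in> carrier T"
  obtain u where u: "u \<in> carrier F" "t = S +>\<^bsub>F\<^esub> u" using tensor_product_cases[OF t] .
  show "tensor_lift K P \<beta> t \<in> carrier P"
    unfolding u(2) tensor_lift_coset[OF u(1)] by (rule linear_maps_closed[OF lift_linear u(1)])
  show "tensor_lift K P \<beta> (a \<odot>\<^bsub>T\<^esub> t) = a \<odot>\<^bsub>P\<^esub> tensor_lift K P \<beta> t" if a: "a \<in> carrier K" for a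
    unfolding u(2) linear_maps_smult[OF proj_linear a u(1), symmetric] tensor_lift_coset[OF u(1)]
      tensor_lift_coset[OF F.smult_closed[OF a u(1)]] by (rule linear_maps_smult[OF lift_linear a u(1)])
  fix t' assume t': "t' \<in> carrier T"
  obtain u' where u': "u' \<in> carrier F" "t' = S +>\<^bsub>F\<^esub> u'" using tensor_product_cases[OF t'] .
  show "tensor_lift K P \<beta> (t \<oplus>\<^bsub>T\<^esub> t') = tensor_lift K P \<beta> t \<oplus>\<^bsub>P\<^esub> tensor_lift K P \<beta> t'"
    unfolding u(2) u'(2) linear_maps_add[OF proj_linear u(1) u'(1), symmetric]
      tensor_lift_coset[OF u(1)] tensor_lift_coset[OF u'(1)]
      tensor_lift_coset[OF F.M.a_closed[OF u(1) u'(1)]]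
    by (rule linear_maps_add[OF lift_linear u(1) u'(1)])
qed

end

lemma pure_tensor_closed:
  "x \<in> carrier M \<Longrightarrow> y \<in> carrier N \<Longrightarrow> pure_tensor K M N x y \<in> carrier (tensor_product K M N)"
  by (rule linear_maps_closed[OF bilinear_maps_left[OF pure_tensor_bilinear]])

end

section \<open>Functoriality of the tensor product\<close>

lemma bilinear_maps_comp:
  assumes "f \<in> linear_maps K M M'" "g \<in> linear_maps K N N'" "\<beta> \<in> bilinear_maps K M' N' P"
  shows "(\<lambda>x y. \<beta> (f x) (g y)) \<in> bilinear_maps K M N P"
  by (rule bilinear_mapsI)
    (auto intro!: linear_maps_comp[OF assms(1) bilinear_maps_left[OF assms(3)]]
      linear_maps_comp[OF assms(2) bilinear_maps_right[OF assms(3)]]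
      linear_maps_closed[OF assms(1)] linear_maps_closed[OF assms(2)])

context
  fixes K :: "('k, 'r) ring_scheme"
    and M :: "('k, 'a, 'm) module_scheme" and N :: "('k, 'b, 'n) module_scheme"
    and M' :: "('k, 'a1, 'm1) module_scheme" and N' :: "('k, 'b1, 'n1) module_scheme"
    and f g
  assumes M: "module K M" and N: "module K N" and M': "module K M'" and N': "module K N'"
    and f: "f \<in> linear_maps K M M'" and g: "g \<in> linear_maps K N N'"
begin

lemma tensor_map_linear:
  "tensor_map K M' N' f g \<in> linear_maps K (tensor_product K M N) (tensor_product K M' N')"
  unfolding tensor_map_def
  by (intro tensor_lift_linear M N module_tensor_product M' N'
      bilinear_maps_comp[OF f g] pure_tensor_bilinear)

lemma tensor_map_pure:
  "x \<in> carrier M \<Longrightarrow> y \<in> carrier N \<Longrightarrow>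
    tensor_map K M' N' f g (pure_tensor K M N x y) = pure_tensor K M' N' (f x) (g y)"
  unfolding tensor_map_def
  by (rule tensor_lift_pure[OF M N module_tensor_product[OF M' N']
      bilinear_maps_comp[OF f g pure_tensor_bilinear[OF M' N']]])

end

lemma tensor_map_comp:
  assumes mod: "module K L" "module K L'" "module K M" "module K M'" "module K N" "module K N'"
    and lin: "f \<in> linear_maps K L M" "f' \<in> linear_maps K L' M'"
      "g \<in> linear_maps K M N" "g' \<in> linear_maps K M' N'"
    and t: "t \<in> carrier (tensor_product K L L')"
  shows "tensor_map K N N' (\<lambda>x. g (f x)) (\<lambda>x. g' (f' x)) t =
    tensor_map K N N' g g' (tensor_map K M M' f f' t)"
proof (rule tensor_product_eqI[OF mod(1,2) module_tensor_product[OF mod(5,6)] _ _ _ t])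
  note gf = linear_maps_comp[OF lin(1,3)] and gf' = linear_maps_comp[OF lin(2,4)]
  show "tensor_map K N N' (\<lambda>x. g (f x)) (\<lambda>x. g' (f' x)) \<in>
      linear_maps K (tensor_product K L L') (tensor_product K N N')"
    by (rule tensor_map_linear[OF mod(1,2,5,6) gf gf'])
  show "(\<lambda>t. tensor_map K N N' g g' (tensor_map K M M' f f' t)) \<in>
      linear_maps K (tensor_product K L L') (tensor_product K N N')"
    by (rule linear_maps_comp[OF tensor_map_linear[OF mod(1-4) lin(1,2)]
          tensor_map_linear[OF mod(3-6) lin(3,4)]])
  fix x y assume xy: "x \<in> carrier L" "y \<in> carrier L'"
  show "tensor_map K N N' (\<lambda>x. g (f x)) (\<lambda>x. g' (f' x)) (pure_tensor K L L' x y) =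
      tensor_map K N N' g g' (tensor_map K M M' f f' (pure_tensor K L L' x y))"
    unfolding tensor_map_pure[OF mod(1,2,5,6) gf gf' xy]
      tensor_map_pure[OF mod(1-4) lin(1,2) xy]
      tensor_map_pure[OF mod(3-6) lin(3,4) linear_maps_closed[OF lin(1) xy(1)]
        linear_maps_closed[OF lin(2) xy(2)]] ..
qed

lemma tensor_map_id:
  assumes "module K M" "module K N" "\<And>x. x \<in> carrier M \<Longrightarrow> f x = x" "\<And>x. x \<in> carrier N \<Longrightarrow> g x = x"
    and "t \<in> carrier (tensor_product K M N)"
  shows "tensor_map K M N f g t = t"
proof (rule tensor_product_eqI[OF assms(1,2) module_tensor_product[OF assms(1,2)] _ linear_maps_id _ assms(5)])
  have f: "f \<in> linear_maps K M M" by (rule linear_maps_cong[OF assms(1) linear_maps_id assms(3)])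
  have g: "g \<in> linear_maps K N N" by (rule linear_maps_cong[OF assms(2) linear_maps_id assms(4)])
  show "tensor_map K M N f g \<in> linear_maps K (tensor_product K M N) (tensor_product K M N)"
    by (rule tensor_map_linear[OF assms(1,2,1,2) f g])
  show "tensor_map K M N f g (pure_tensor K M N x y) = pure_tensor K M N x y"
    if "x \<in> carrier M" "y \<in> carrier N" for x y
    unfolding tensor_map_pure[OF assms(1,2,1,2) f g that] using that assms by simp
qed

section \<open>The associator\<close>

context
  fixes K :: "('k, 'r) ring_scheme" and L :: "('k, 'c, 'l) module_scheme"
    and M :: "('k, 'a, 'm) module_scheme" and N :: "('k, 'b, 'n) module_scheme"
  assumes L: "module K L" and M: "module K M" and N: "module K N"
begin

private abbreviation (input) "MN \<equiv> tensor_product K M N"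
private abbreviation (input) "LM \<equiv> tensor_product K L M"
private abbreviation (input) "LMN \<equiv> tensor_product K L MN"
private abbreviation (input) "\<alpha> z \<equiv> \<lambda>x y. pure_tensor K L MN x (pure_tensor K M N y z)"

private lemma MN: "module K MN" by (rule module_tensor_product[OF M N])
private lemma LM: "module K LM" by (rule module_tensor_product[OF L M])
private lemma LMN: "module K LMN" by (rule module_tensor_product[OF L MN])

private lemma \<alpha>: "z \<in> carrier N \<Longrightarrow> \<alpha> z \<in> bilinear_maps K L M LMN"
  by (rule bilinear_maps_comp[OF linear_maps_id _ pure_tensor_bilinear[OF L MN]])
    (rule bilinear_maps_left[OF pure_tensor_bilinear[OF M N]])

text \<open>Linearity in \<open>z\<close> is not immediate, because \<open>z\<close> enters through
  the bilinear map that is lifted. As functions of \<open>t\<close> both sides of each law are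
  linear, so it suffices to compare them on pure tensors.\<close>

private lemma assoc_bilinear: "(\<lambda>t z. tensor_lift K LMN (\<alpha> z) t) \<in> bilinear_maps K LM N LMN"
proof (rule bilinear_mapsI)
  interpret N: module K N by (rule N)
  fix z assume z: "z \<in> carrier N"
  show "tensor_lift K LMN (\<alpha> z) \<in> linear_maps K LM LMN"
    by (rule tensor_lift_linear[OF L M LMN \<alpha>[OF z]])
next
  interpret N: module K N by (rule N)
  fix t assume t: "t \<in> carrier LM"
  note lin = tensor_lift_linear[OF L M LMN \<alpha>]
  note pure = tensor_lift_pure[OF L M LMN \<alpha>]
  note inner = bilinear_maps_right[OF pure_tensor_bilinear[OF M N]]
  note outer = bilinear_maps_right[OF pure_tensor_bilinear[OF L MN]]
  show "(\<lambda>z. tensor_lift K LMN (\<alpha> z) t) \<in> linear_maps K N LMN"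
  proof (rule linear_mapsI)
    fix z assume z: "z \<in> carrier N"
    show "tensor_lift K LMN (\<alpha> z) t \<in> carrier LMN" by (rule linear_maps_closed[OF lin[OF z] t])
    fix z' assume z': "z' \<in> carrier N"
    show "tensor_lift K LMN (\<alpha> (z \<oplus>\<^bsub>N\<^esub> z')) t = tensor_lift K LMN (\<alpha> z) t \<oplus>\<^bsub>LMN\<^esub> tensor_lift K LMN (\<alpha> z') t"
      by (rule tensor_product_eqI[OF L M LMN lin[OF N.M.a_closed[OF z z']]
            linear_maps_plus[OF LM LMN lin[OF z] lin[OF z']] _ t])
        (simp add: pure z z' linear_maps_add[OF inner] linear_maps_add[OF outer]
          pure_tensor_closed[OF M N])
  next
    fix a z assume a: "a \<in> carrier K" and z: "z \<in> carrier N"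
    show "tensor_lift K LMN (\<alpha> (a \<odot>\<^bsub>N\<^esub> z)) t = a \<odot>\<^bsub>LMN\<^esub> tensor_lift K LMN (\<alpha> z) t"
      by (rule tensor_product_eqI[OF L M LMN lin[OF N.smult_closed[OF a z]]
            linear_maps_scale[OF LM LMN lin[OF z] a] _ t])
        (simp add: pure a z linear_maps_smult[OF inner] linear_maps_smult[OF outer]
          pure_tensor_closed[OF M N])
  qed
qed

lemma tensor_assoc_linear:
  "tensor_assoc K L M N \<in> linear_maps K (tensor_product K (tensor_product K L M) N)
    (tensor_product K L (tensor_product K M N))"
  unfolding tensor_assoc_def Let_def by (rule tensor_lift_linear[OF LM N LMN assoc_bilinear])

lemma tensor_assoc_pure:
  assumes "x \<in> carrier L" "y \<in> carrier M" "z \<in> carrier N"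
  shows "tensor_assoc K L M N (pure_tensor K (tensor_product K L M) N (pure_tensor K L M x y) z) =
    pure_tensor K L (tensor_product K M N) x (pure_tensor K M N y z)"
  unfolding tensor_assoc_def Let_def
    tensor_lift_pure[OF LM N LMN assoc_bilinear pure_tensor_closed[OF L M assms(1,2)] assms(3)]
  by (rule tensor_lift_pure[OF L M LMN \<alpha>[OF assms(3)] assms(1,2)])

end

section \<open>Coalgebra automorphisms\<close>

text \<open>\<open>coalgebra_auto\<close> also demands a bijection that is \<open>undefined\<close>
  off the carrier. Separating the coalgebra conditions allows work with maps whose values off the
  carrier are arbitrary; they are restricted only at the end.\<close>

definition coalgebra_end ::
  "('k, 'r) ring_scheme \<Rightarrow> ('k, 'c, 'm) coalgebra_scheme \<Rightarrow> ('c \<Rightarrow> 'c) set"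
  where "coalgebra_end K C =
    {f \<in> linear_maps K C C.
      \<forall>c \<in> carrier C. comult C (f c) = tensor_map K C C f f (comult C c) \<and>
                      counit C (f c) = counit C c}"

lemma coalgebra_auto_eq: "coalgebra_auto K C = coalgebra_end K C \<inter> Bij (carrier C)"
  by (auto simp: coalgebra_auto_def coalgebra_end_def)

lemma coalgebra_end_linear: "f \<in> coalgebra_end K C \<Longrightarrow> f \<in> linear_maps K C C"
  by (simp add: coalgebra_end_def)

lemma coalgebra_end_closed: "f \<in> coalgebra_end K C \<Longrightarrow> c \<in> carrier C \<Longrightarrow> f c \<in> carrier C"
  by (rule linear_maps_closed[OF coalgebra_end_linear])

lemma coalgebra_end_comult:
  "f \<in> coalgebra_end K C \<Longrightarrow> c \<in> carrier C \<Longrightarrow>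
    comult C (f c) = tensor_map K C C f f (comult C c)"
  by (simp add: coalgebra_end_def)

lemma coalgebra_end_counit:
  "f \<in> coalgebra_end K C \<Longrightarrow> c \<in> carrier C \<Longrightarrow> counit C (f c) = counit C c"
  by (simp add: coalgebra_end_def)

context coalgebra
begin

lemma module_C: "module K C"
  by (rule module_axioms)

lemma comult_closed: "c \<in> carrier C \<Longrightarrow> comult C c \<in> carrier (tensor_product K C C)"
  by (rule linear_maps_closed[OF comult_linear])

lemma tensor_map_cong:
  assumes f: "f \<in> linear_maps K C C" and eq: "\<And>c. c \<in> carrier C \<Longrightarrow> g c = f c"
    and t: "t \<in> carrier (tensor_product K C C)"
  shows "tensor_map K C C g g t = tensor_map K C C f f t"
proof -
  note m = module_C
  have g: "g \<in> linear_maps K C C" by (rule linear_maps_cong[OF m f eq])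
  show ?thesis
    by (rule tensor_product_eqI[OF m m module_tensor_product[OF m m]
          tensor_map_linear[OF m m m m g g] tensor_map_linear[OF m m m m f f] _ t])
      (simp add: tensor_map_pure[OF m m m m f f] tensor_map_pure[OF m m m m g g] eq)
qed

text \<open>Lets an endomorphism be replaced by its restriction to the carrier, or a composite by
  \<open>compose\<close>, as membership in the automorphism group requires.\<close>

lemma coalgebra_end_cong:
  assumes f: "f \<in> coalgebra_end K C" and eq: "\<And>c. c \<in> carrier C \<Longrightarrow> g c = f c"
  shows "g \<in> coalgebra_end K C"
proof -
  have "g \<in> linear_maps K C C"
    by (rule linear_maps_cong[OF module_C coalgebra_end_linear[OF f] eq])
  then show ?thesis
    using coalgebra_end_comult[OF f] coalgebra_end_counit[OF f]
      tensor_map_cong[OF coalgebra_end_linear[OF f] eq comult_closed]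
    by (simp add: coalgebra_end_def eq)
qed

lemma coalgebra_end_comp:
  assumes f: "f \<in> coalgebra_end K C" and g: "g \<in> coalgebra_end K C"
  shows "(\<lambda>c. g (f c)) \<in> coalgebra_end K C"
proof -
  note m = module_C
  note fl = coalgebra_end_linear[OF f] and gl = coalgebra_end_linear[OF g]
  have "comult C (g (f c)) = tensor_map K C C (\<lambda>c. g (f c)) (\<lambda>c. g (f c)) (comult C c)"
    if c: "c \<in> carrier C" for c
    unfolding tensor_map_comp[OF m m m m m m fl fl gl gl comult_closed[OF c]]
      coalgebra_end_comult[OF g linear_maps_closed[OF fl c]] coalgebra_end_comult[OF f c] ..
  then show ?thesis
    using coalgebra_end_counit[OF f] coalgebra_end_counit[OF g] linear_maps_closed[OF fl]
      linear_maps_comp[OF fl gl]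
    by (simp add: coalgebra_end_def)
qed

lemma coalgebra_end_id: "(\<lambda>c. c) \<in> coalgebra_end K C"
  using tensor_map_id[OF module_C module_C _ _ comult_closed, of "\<lambda>c. c" "\<lambda>c. c"] linear_maps_id
  by (simp add: coalgebra_end_def)

text \<open>Compatibility of \<open>g\<close> with the structure is inherited from \<open>f\<close>:
  the laws for \<open>f\<close> are written at points \<open>g x\<close>, and \<open>g\<close> is
  applied to both sides.\<close>

lemma coalgebra_end_inverse:
  assumes f: "f \<in> coalgebra_end K C"
    and g: "\<And>c. c \<in> carrier C \<Longrightarrow> g c \<in> carrier C"
    and fg: "\<And>c. c \<in> carrier C \<Longrightarrow> f (g c) = c" and gf: "\<And>c. c \<in> carrier C \<Longrightarrow> g (f c) = c"
  shows "g \<in> coalgebra_end K C"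
proof -
  note m = module_C
  note fl = coalgebra_end_linear[OF f]
  have gl: "g \<in> linear_maps K C C"
  proof (rule linear_mapsI[OF g])
    fix x assume x: "x \<in> carrier C"
    show "g (a \<odot>\<^bsub>C\<^esub> x) = a \<odot>\<^bsub>C\<^esub> g x" if a: "a \<in> carrier K" for a
      using gf[of "a \<odot>\<^bsub>C\<^esub> g x"] linear_maps_smult[OF fl a g[OF x]] fg[OF x] a g[OF x] by simp
    fix y assume y: "y \<in> carrier C"
    show "g (x \<oplus>\<^bsub>C\<^esub> y) = g x \<oplus>\<^bsub>C\<^esub> g y"
      using gf[of "g x \<oplus>\<^bsub>C\<^esub> g y"] linear_maps_add[OF fl g[OF x] g[OF y]] fg[OF x] fg[OF y]
        g[OF x] g[OF y] by simp
  qed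
  have "comult C (g c) = tensor_map K C C g g (comult C c)" if c: "c \<in> carrier C" for c
  proof -
    \<comment> \<open>Apply \<open>g \<otimes> g\<close> to
      \<open>comult (f (g c)) = (f \<otimes> f) (comult (g c))\<close>; the composite on the right
      acts as the identity.\<close>
    have "tensor_map K C C g g (comult C (f (g c))) =
      tensor_map K C C (\<lambda>c. g (f c)) (\<lambda>c. g (f c)) (comult C (g c))"
      unfolding coalgebra_end_comult[OF f g[OF c]]
        tensor_map_comp[OF m m m m m m fl fl gl gl comult_closed[OF g[OF c]]] ..
    also have "\<dots> = comult C (g c)"
      by (rule tensor_map_id[OF m m gf gf comult_closed[OF g[OF c]]])
    finally show ?thesis using fg[OF c] by simp
  qed
  moreover have "counit C (g c) = counit C c" if "c \<in> carrier C" for c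
    using coalgebra_end_counit[OF f g[OF that]] fg[OF that] by simp
  ultimately show ?thesis using gl by (simp add: coalgebra_end_def)
qed

lemma coalgebra_autoI:
  assumes f: "f \<in> coalgebra_end K C" and g: "\<And>c. c \<in> carrier C \<Longrightarrow> g c \<in> carrier C"
    and "\<And>c. c \<in> carrier C \<Longrightarrow> f (g c) = c" "\<And>c. c \<in> carrier C \<Longrightarrow> g (f c) = c"
  shows "restrict f (carrier C) \<in> coalgebra_auto K C"
proof -
  have "bij_betw (restrict f (carrier C)) (carrier C) (carrier C)"
    by (rule bij_betw_byWitness[where f' = g])
      (use assms(2-) coalgebra_end_closed[OF f] in auto)
  then show ?thesis
    using coalgebra_end_cong[OF f, of "restrict f (carrier C)"]
    by (simp add: coalgebra_auto_eq Bij_def)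
qed

lemma subgroup_coalgebra_auto: "subgroup (coalgebra_auto K C) (BijGroup (carrier C))"
proof (rule group.subgroupI[OF group_BijGroup])
  show "coalgebra_auto K C \<subseteq> carrier (BijGroup (carrier C))"
    by (auto simp: coalgebra_auto_eq BijGroup_def)
  show "coalgebra_auto K C \<noteq> {}"
    using coalgebra_autoI[OF coalgebra_end_id, of "\<lambda>c. c"] by auto
next
  fix f assume f: "f \<in> coalgebra_auto K C"
  then have "f \<in> Bij (carrier C)" "f \<in> coalgebra_end K C" by (auto simp: coalgebra_auto_eq)
  then have bij: "bij_betw f (carrier C) (carrier C)" by (simp add: Bij_def)
  let ?g = "inv_into (carrier C) f"
  have g: "?g c \<in> carrier C" "f (?g c) = c" "?g (f c) = c" if "c \<in> carrier C" for c
    using that bij by (auto simp: bij_betw_def f_inv_into_f inv_into_into)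
  have "restrict ?g (carrier C) \<in> coalgebra_auto K C"
    by (rule coalgebra_autoI[OF coalgebra_end_inverse[OF \<open>f \<in> coalgebra_end K C\<close>], where g = f])
      (simp_all add: g coalgebra_end_closed[OF \<open>f \<in> coalgebra_end K C\<close>])
  then show "inv\<^bsub>BijGroup (carrier C)\<^esub> f \<in> coalgebra_auto K C"
    using \<open>f \<in> Bij (carrier C)\<close> by (simp add: inv_BijGroup)
next
  fix f g assume "f \<in> coalgebra_auto K C" "g \<in> coalgebra_auto K C"
  then have fg: "f \<in> coalgebra_end K C" "g \<in> coalgebra_end K C"
    "f \<in> Bij (carrier C)" "g \<in> Bij (carrier C)"
    by (auto simp: coalgebra_auto_eq)
  have "compose (carrier C) f g \<in> coalgebra_end K C"
    by (rule coalgebra_end_cong[OF coalgebra_end_comp[OF fg(2,1)]]) (simp add: compose_def)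
  then show "f \<otimes>\<^bsub>BijGroup (carrier C)\<^esub> g \<in> coalgebra_auto K C"
    using fg by (simp add: BijGroup_def coalgebra_auto_eq compose_Bij)
qed

lemma group_coalgebra_AutoGroup: "group (coalgebra_AutoGroup K C)"
  unfolding coalgebra_AutoGroup_def
  by (rule subgroup.subgroup_is_group[OF subgroup_coalgebra_auto group_BijGroup])

lemma grouplikes_image:
  assumes f: "f \<in> coalgebra_end K C" and c: "c \<in> grouplikes K C"
  shows "f c \<in> grouplikes K C"
proof -
  note m = module_C
  note fl = coalgebra_end_linear[OF f]
  have c': "c \<in> carrier C" "comult C c = pure_tensor K C C c c" "counit C c = \<one>\<^bsub>K\<^esub>"
    using c by (auto simp: grouplikes_def)
  have "comult C (f c) = pure_tensor K C C (f c) (f c)"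
    unfolding coalgebra_end_comult[OF f c'(1)] c'(2) tensor_map_pure[OF m m m m fl fl c'(1,1)] ..
  then show ?thesis
    using coalgebra_end_counit[OF f c'(1)] c'(3) linear_maps_closed[OF fl c'(1)]
    by (simp add: grouplikes_def)
qed

end

lemma coalgebra_AutoGroup_simps:
  "carrier (coalgebra_AutoGroup K C) = coalgebra_auto K C"
  "\<one>\<^bsub>coalgebra_AutoGroup K C\<^esub> = (\<lambda>c\<in>carrier C. c)"
  "f \<in> coalgebra_auto K C \<Longrightarrow> g \<in> coalgebra_auto K C \<Longrightarrow>
    f \<otimes>\<^bsub>coalgebra_AutoGroup K C\<^esub> g = compose (carrier C) f g"
  by (auto simp: coalgebra_AutoGroup_def BijGroup_def coalgebra_auto_eq)


section \<open>Digraph automorphisms and the affine group\<close>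

lemma subgroup_digraph_auto: "subgroup (digraph_auto G) (BijGroup (pverts G))"
proof (rule group.subgroupI[OF group_BijGroup])
  show "digraph_auto G \<subseteq> carrier (BijGroup (pverts G))"
    by (auto simp: digraph_auto_def BijGroup_def)
  have "(\<lambda>v\<in>pverts G. v) \<in> digraph_auto G" by (simp add: digraph_auto_def id_Bij)
  then show "digraph_auto G \<noteq> {}" by blast
next
  fix \<sigma> assume \<sigma>: "\<sigma> \<in> digraph_auto G"
  then have B: "\<sigma> \<in> Bij (pverts G)" by (simp add: digraph_auto_def)
  then have bij: "bij_betw \<sigma> (pverts G) (pverts G)" by (simp add: Bij_def)
  have "(v, w) \<in> parcs G \<longleftrightarrow> (inv_into (pverts G) \<sigma> v, inv_into (pverts G) \<sigma> w) \<in> parcs G"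
    if "v \<in> pverts G" "w \<in> pverts G" for v w
  proof -
    have "inv_into (pverts G) \<sigma> x \<in> pverts G" "\<sigma> (inv_into (pverts G) \<sigma> x) = x"
      if "x \<in> pverts G" for x
      using bij that by (auto simp: bij_betw_def f_inv_into_f inv_into_into)
    then show ?thesis using \<sigma> that by (simp add: digraph_auto_def)
  qed
  then show "inv\<^bsub>BijGroup (pverts G)\<^esub> \<sigma> \<in> digraph_auto G"
    using restrict_inv_into_Bij[OF B] by (simp add: digraph_auto_def inv_BijGroup[OF B])
next
  fix \<sigma> \<tau> assume "\<sigma> \<in> digraph_auto G" "\<tau> \<in> digraph_auto G"
  then show "\<sigma> \<otimes>\<^bsub>BijGroup (pverts G)\<^esub> \<tau> \<in> digraph_auto G"
    using Bij_imp_funcset[of \<tau> "pverts G"]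
    by (auto simp: digraph_auto_def BijGroup_def compose_Bij compose_eq Pi_iff)
qed

lemma group_digraph_AutoGroup: "group (digraph_AutoGroup G)"
  unfolding digraph_AutoGroup_def
  by (rule subgroup.subgroup_is_group[OF subgroup_digraph_auto group_BijGroup])

lemma digraph_AutoGroup_simps:
  "carrier (digraph_AutoGroup G) = digraph_auto G"
  "\<one>\<^bsub>digraph_AutoGroup G\<^esub> = (\<lambda>v\<in>pverts G. v)"
  "\<sigma> \<in> digraph_auto G \<Longrightarrow> \<tau> \<in> digraph_auto G \<Longrightarrow>
    \<sigma> \<otimes>\<^bsub>digraph_AutoGroup G\<^esub> \<tau> = compose (pverts G) \<sigma> \<tau>"
  by (auto simp: digraph_AutoGroup_def BijGroup_def digraph_auto_def)

lemma affine_group_simps: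
  "carrier (affine_group K) = carrier K \<times> (carrier K - {\<zero>\<^bsub>K\<^esub>})"
  "\<one>\<^bsub>affine_group K\<^esub> = (\<zero>\<^bsub>K\<^esub>, \<one>\<^bsub>K\<^esub>)"
  "(n, h) \<otimes>\<^bsub>affine_group K\<^esub> (n', h') = (n \<oplus>\<^bsub>K\<^esub> h \<otimes>\<^bsub>K\<^esub> n', h \<otimes>\<^bsub>K\<^esub> h')"
  by (auto simp: affine_group_def semidirect_product_def)

lemma group_affine_group:
  assumes "field K" shows "group (affine_group K)"
proof -
  interpret field K by fact
  show ?thesis
  proof (rule groupI)
    fix x assume "x \<in> carrier (affine_group K)"
    then obtain n h where x: "x = (n, h)" "n \<in> carrier K" "h \<in> carrier K" "h \<noteq> \<zero>\<^bsub>K\<^esub>"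
      by (auto simp: affine_group_simps)
    then have "h \<in> Units K" by (simp add: field_Units)
    show "\<exists>y\<in>carrier (affine_group K). y \<otimes>\<^bsub>affine_group K\<^esub> x = \<one>\<^bsub>affine_group K\<^esub>"
      \<comment> \<open>From \<open>(m, k) (n, h) = (m + k n, k h)\<close> a left inverse must have
        \<open>k = h^{-1}\<close> and \<open>m = - k n\<close>.\<close>
      by (rule bexI[of _ "(\<ominus>\<^bsub>K\<^esub> (inv\<^bsub>K\<^esub> h \<otimes>\<^bsub>K\<^esub> n), inv\<^bsub>K\<^esub> h)"])
        (use x \<open>h \<in> Units K\<close> Units_inv_Units in \<open>auto simp: affine_group_simps l_neg field_Units\<close>)
  qed (auto simp: affine_group_simps m_assoc a_assoc r_distr integral_iff)
qed

declare free_module_simps [simp del]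

section \<open>The coalgebra of a digraph\<close>

text \<open>The basis consists of the paths of length at most one together with, for every loop at \<open>v\<close>,
  the path \<open>[v, v, v]\<close> of length two.  This extra element makes the automorphisms of the part
  spanned by \<open>[v]\<close>, \<open>[v, v]\<close>, \<open>[v, v, v]\<close> dual to those of \<open>K[x]/(x\<^sup>3)\<close>; without it a
  loop would only contribute a factor \<open>K\<^sup>\<times>\<close>, because \<open>[v] - [w]\<close> vanishes for \<open>v = w\<close>.\<close>

definition path_basis :: "'v pair_pre_digraph \<Rightarrow> 'v list set"
  where "path_basis G =
    {[v] | v. v \<in> pverts G} \<union> {[v, w] | v w. (v, w) \<in> parcs G} \<union> {[v, v, v] | v. (v, v) \<in> parcs G}"

text \<open>Deconcatenation: a path is cut at each of its vertices, and the cut vertex belongs to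
  both pieces. The module is a parameter because the coalgebra whose tensor square is meant is
  itself built from this function.\<close>

fun path_comult ::
  "('k, 'r) ring_scheme \<Rightarrow> ('k, 'v list \<Rightarrow> 'k, 'm) module_scheme \<Rightarrow> 'v list \<Rightarrow>
   (('v list \<Rightarrow> 'k) \<times> ('v list \<Rightarrow> 'k) \<Rightarrow> 'k) set"
  where
    "path_comult K M [v] = pure_tensor K M M (free_gen K [v]) (free_gen K [v])"
  | "path_comult K M [v, w] =
      pure_tensor K M M (free_gen K [v]) (free_gen K [v, w]) \<oplus>\<^bsub>tensor_product K M M\<^esub>
      pure_tensor K M M (free_gen K [v, w]) (free_gen K [w])"
  | "path_comult K M [u, v, w] =
      pure_tensor K M M (free_gen K [u]) (free_gen K [u, v, w]) \<oplus>\<^bsub>tensor_product K M M\<^esub>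
      (pure_tensor K M M (free_gen K [u, v]) (free_gen K [v, w]) \<oplus>\<^bsub>tensor_product K M M\<^esub>
       pure_tensor K M M (free_gen K [u, v, w]) (free_gen K [w]))"
  | "path_comult K M _ = \<zero>\<^bsub>tensor_product K M M\<^esub>"

definition path_counit :: "('k, 'r) ring_scheme \<Rightarrow> 'v list \<Rightarrow> 'k"
  where "path_counit K b = (if length b = 1 then \<one>\<^bsub>K\<^esub> else \<zero>\<^bsub>K\<^esub>)"

definition path_coalgebra ::
  "('k, 'r) ring_scheme \<Rightarrow> 'v pair_pre_digraph \<Rightarrow> ('k, 'v list \<Rightarrow> 'k) coalgebra"
  where "path_coalgebra K G =
    (let F = free_module K (path_basis G) in
      \<lparr>carrier = carrier F, monoid.mult = undefined, one = undefined,
       ring.zero = \<zero>\<^bsub>F\<^esub>, ring.add = (\<oplus>\<^bsub>F\<^esub>), smult = (\<odot>\<^bsub>F\<^esub>),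
       comult = free_lift K (tensor_product K F F) (path_comult K F),
       counit = free_lift K (regular_module K) (path_counit K)\<rparr>)"

text \<open>The comultiplication is defined with the tensor square of the free module; this moves it
  to the tensor square of \<open>C\<close>, a record with further fields but the same carrier,
  addition and scalar multiplication.\<close>

lemma tensor_product_cong:
  fixes M :: "('k, 'a, 'm) module_scheme" and M' :: "('k, 'a, 'm1) module_scheme"
    and N :: "('k, 'b, 'n) module_scheme" and N' :: "('k, 'b, 'n1) module_scheme"
  assumes "carrier M = carrier M'" "ring.add M = ring.add M'" "smult M = smult M'"
    and "carrier N = carrier N'" "ring.add N = ring.add N'" "smult N = smult N'"
  shows "tensor_product K M N = tensor_product K M' N'"
    and "pure_tensor K M N = pure_tensor K M' N'"
proof -
  have "tensor_kernel K M N = tensor_kernel K M' N'"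
    unfolding tensor_kernel_def tensor_relations_def by (simp only: assms)
  then show "tensor_product K M N = tensor_product K M' N'"
    and "pure_tensor K M N = pure_tensor K M' N'"
    unfolding tensor_product_def pure_tensor_def fun_eq_iff by (simp_all only: assms) simp
qed

section \<open>Coalgebra axioms of the path coalgebra\<close>

locale digraph_coalgebra = K?: field K + G: pair_wf_digraph G
  for K :: "('k, 'r) ring_scheme" (structure) and G :: "'v pair_pre_digraph"
begin

abbreviation "B \<equiv> path_basis G"
abbreviation "C \<equiv> path_coalgebra K G"
abbreviation gen :: "'v list \<Rightarrow> 'v list \<Rightarrow> 'k" where "gen \<equiv> free_gen K"
abbreviation "CC \<equiv> tensor_product K C C"
abbreviation tensor (infixl "\<otimes>\<^sub>C" 75) where "x \<otimes>\<^sub>C y \<equiv> pure_tensor K C C x y"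

lemma path_basis_simps [simp]:
  "[v] \<in> B \<longleftrightarrow> v \<in> pverts G"
  "[v, w] \<in> B \<longleftrightarrow> (v, w) \<in> parcs G"
  "[u, v, w] \<in> B \<longleftrightarrow> u = v \<and> v = w \<and> (v, v) \<in> parcs G"
  by (auto simp: path_basis_def)

lemma path_basis_cases:
  assumes "b \<in> B"
  obtains v where "b = [v]" "v \<in> pverts G"
  | v w where "b = [v, w]" "(v, w) \<in> parcs G"
  | v where "b = [v, v, v]" "(v, v) \<in> parcs G"
  using assms by (auto simp: path_basis_def)

lemma arc_verts: "(v, w) \<in> parcs G \<Longrightarrow> v \<in> pverts G" "(v, w) \<in> parcs G \<Longrightarrow> w \<in> pverts G"
  using G.arc_fst_in_verts G.arc_snd_in_verts by fastforce+

lemma C_carrier: "carrier C = carrier (free_module K B)"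
  and C_zero: "\<zero>\<^bsub>C\<^esub> = (\<lambda>x. \<zero>)"
  and C_add: "u \<oplus>\<^bsub>C\<^esub> w = (\<lambda>x. u x \<oplus> w x)"
  and C_smult: "a \<odot>\<^bsub>C\<^esub> u = (\<lambda>x. a \<otimes> u x)"
  by (simp_all add: path_coalgebra_def Let_def free_module_simps)

lemma linear_maps_C: "linear_maps K C N = linear_maps K (free_module K B) N"
  by (simp add: linear_maps_def path_coalgebra_def Let_def)

lemma tensor_C:
  "CC = tensor_product K (free_module K B) (free_module K B)"
  "pure_tensor K C C = pure_tensor K (free_module K B) (free_module K B)"
  by (rule tensor_product_cong; simp add: path_coalgebra_def Let_def)+

lemma module_C: "module K C"
proof -
  let ?F = "free_module K B"
  have eq: "carrier C = carrier ?F" "\<zero>\<^bsub>C\<^esub> = \<zero>\<^bsub>?F\<^esub>" "ring.add C = ring.add ?F" "smult C = smult ?F"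
    by (simp_all add: path_coalgebra_def Let_def)
  interpret F: module K ?F by (rule module_free_module) (rule is_cring)
  show ?thesis
  proof (intro moduleI abelian_groupI is_cring, unfold eq)
    show "\<exists>y\<in>carrier ?F. y \<oplus>\<^bsub>?F\<^esub> x = \<zero>\<^bsub>?F\<^esub>" if "x \<in> carrier ?F" for x
      using F.M.a_inv_closed[OF that] F.M.l_neg[OF that] by blast
  qed (fact F.M.a_closed F.M.zero_closed F.M.a_assoc F.M.a_comm F.M.l_zero F.smult_closed
      F.smult_l_distr F.smult_r_distr F.smult_assoc1 F.smult_one)+
qed

lemma module_K: "module K (regular_module K)"
  by (rule module_regular_module) (rule is_cring)

lemma module_CC: "module K CC"
  by (rule module_tensor_product[OF module_C module_C])

sublocale C: module K C by (rule module_C)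
sublocale CC: module K CC by (rule module_CC)

lemma gen_closed [simp]: "b \<in> B \<Longrightarrow> gen b \<in> carrier C"
  unfolding C_carrier by (rule free_gen_closed) (rule is_cring)

lemma gen_apply: "gen b x = (if x = b then \<one> else \<zero>)"
  by (simp add: free_gen_def)

lemma C_apply_closed [simp]: "u \<in> carrier C \<Longrightarrow> u x \<in> carrier K"
  unfolding C_carrier free_module_simps by blast

lemma C_apply_outside: "u \<in> carrier C \<Longrightarrow> x \<notin> B \<Longrightarrow> u x = \<zero>"
  unfolding C_carrier free_module_simps by blast

lemma tensor_closed [simp]: "x \<in> carrier C \<Longrightarrow> y \<in> carrier C \<Longrightarrow> x \<otimes>\<^sub>C y \<in> carrier CC"
  by (rule pure_tensor_closed[OF module_C module_C])

lemma linear_maps_C_eqI: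
  assumes "module K P" "f \<in> linear_maps K C P" "f' \<in> linear_maps K C P"
    and "\<And>b. b \<in> B \<Longrightarrow> f (gen b) = f' (gen b)" "u \<in> carrier C"
  shows "f u = f' u"
  using linear_maps_free_module_eqI[of K P f B f'] assms by (simp add: linear_maps_C C_carrier)

lemma comult_linear: "comult C \<in> linear_maps K C CC"
  and comult_gen: "b \<in> B \<Longrightarrow> comult C (gen b) = path_comult K C b"
proof -
  let ?F = "free_module K B"
  have F: "module K ?F" by (rule module_free_module) (rule is_cring)
  have eq: "path_comult K ?F b = path_comult K C b" for b
    by (rule path_comult.cases[of "(K, C, b)"]) (auto simp: tensor_C)
  have cl: "path_comult K C \<in> B \<rightarrow> carrier CC"
    by (auto elim!: path_basis_cases simp: arc_verts)
  then have cl': "path_comult K ?F \<in> B \<rightarrow> carrier (tensor_product K ?F ?F)"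
    unfolding eq[abs_def] tensor_C .
  have C: "comult C = free_lift K (tensor_product K ?F ?F) (path_comult K ?F)"
    by (simp add: path_coalgebra_def Let_def)
  show "comult C \<in> linear_maps K C CC"
    unfolding C linear_maps_C tensor_C
    by (rule free_lift_linear[OF module_tensor_product[OF F F] cl'])
  show "comult C (gen b) = path_comult K C b" if "b \<in> B"
    unfolding C free_lift_gen[OF module_tensor_product[OF F F] cl' that] eq ..
qed

lemma counit_linear: "counit C \<in> linear_maps K C (regular_module K)"
  and counit_gen: "b \<in> B \<Longrightarrow> counit C (gen b) = path_counit K b"
proof -
  have C: "counit C = free_lift K (regular_module K) (path_counit K)"
    by (simp add: path_coalgebra_def Let_def)
  have cl: "path_counit K \<in> B \<rightarrow> carrier (regular_module K)"
    by (auto simp: path_counit_def)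
  show "counit C \<in> linear_maps K C (regular_module K)"
    unfolding C linear_maps_C by (rule free_lift_linear[OF module_K cl])
  show "counit C (gen b) = path_counit K b" if "b \<in> B"
    unfolding C by (rule free_lift_gen[OF module_K cl that])
qed

lemma comult_closed [simp]: "u \<in> carrier C \<Longrightarrow> comult C u \<in> carrier CC"
  by (rule linear_maps_closed[OF comult_linear])

lemma counit_closed [simp]: "u \<in> carrier C \<Longrightarrow> counit C u \<in> carrier K"
  using linear_maps_closed[OF counit_linear] by simp

lemma comult_gen_simps:
  "v \<in> pverts G \<Longrightarrow> comult C (gen [v]) = gen [v] \<otimes>\<^sub>C gen [v]"
  "(v, w) \<in> parcs G \<Longrightarrow>
    comult C (gen [v, w]) = gen [v] \<otimes>\<^sub>C gen [v, w] \<oplus>\<^bsub>CC\<^esub> gen [v, w] \<otimes>\<^sub>C gen [w]"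
  "(v, v) \<in> parcs G \<Longrightarrow>
    comult C (gen [v, v, v]) = gen [v] \<otimes>\<^sub>C gen [v, v, v] \<oplus>\<^bsub>CC\<^esub>
      (gen [v, v] \<otimes>\<^sub>C gen [v, v] \<oplus>\<^bsub>CC\<^esub> gen [v, v, v] \<otimes>\<^sub>C gen [v])"
  by (simp_all add: comult_gen)

lemma counit_gen_simps:
  "v \<in> pverts G \<Longrightarrow> counit C (gen [v]) = \<one>"
  "(v, w) \<in> parcs G \<Longrightarrow> counit C (gen [v, w]) = \<zero>"
  "(v, v) \<in> parcs G \<Longrightarrow> counit C (gen [v, v, v]) = \<zero>"
  by (simp_all add: counit_gen path_counit_def)

text \<open>Both sides are linear in \<open>c\<close>; on a basis path the counit vanishes on every
  piece of positive length, so a single term of the deconcatenation survives.\<close>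

lemma counital:
  assumes "c \<in> carrier C"
  shows "tensor_lift K C (\<lambda>x y. counit C x \<odot>\<^bsub>C\<^esub> y) (comult C c) = c" (is "?l (comult C c) = c")
    and "tensor_lift K C (\<lambda>x y. counit C y \<odot>\<^bsub>C\<^esub> x) (comult C c) = c" (is "?r (comult C c) = c")
proof -
  have \<epsilon>: "counit C (x \<oplus>\<^bsub>C\<^esub> y) = counit C x \<oplus> counit C y"
    if "x \<in> carrier C" "y \<in> carrier C" for x y
    using linear_maps_add[OF counit_linear that] by simp
  have \<epsilon>': "counit C (a \<odot>\<^bsub>C\<^esub> x) = a \<otimes> counit C x"
    if "a \<in> carrier K" "x \<in> carrier C" for a x
    using linear_maps_smult[OF counit_linear that] by simp
  have swap: "b \<odot>\<^bsub>C\<^esub> (a \<odot>\<^bsub>C\<^esub> x) = a \<odot>\<^bsub>C\<^esub> (b \<odot>\<^bsub>C\<^esub> x)"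
    if "a \<in> carrier K" "b \<in> carrier K" "x \<in> carrier C" for a b x
    using that by (simp add: m_comm flip: C.smult_assoc1)
  have bl: "(\<lambda>x y. counit C x \<odot>\<^bsub>C\<^esub> y) \<in> bilinear_maps K C C C"
    by (intro bilinear_mapsI linear_mapsI)
      (simp_all add: \<epsilon> \<epsilon>' C.smult_l_distr C.smult_r_distr C.smult_assoc1 swap)
  have br: "(\<lambda>x y. counit C y \<odot>\<^bsub>C\<^esub> x) \<in> bilinear_maps K C C C"
    by (intro bilinear_mapsI linear_mapsI)
      (simp_all add: \<epsilon> \<epsilon>' C.smult_l_distr C.smult_r_distr C.smult_assoc1 swap)
  note l = tensor_lift_linear[OF module_C module_C module_C bl]
  note r = tensor_lift_linear[OF module_C module_C module_C br]
  note pl = tensor_lift_pure[OF module_C module_C module_C bl]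
  note pr = tensor_lift_pure[OF module_C module_C module_C br]
  show "?l (comult C c) = c"
  proof (rule linear_maps_C_eqI[OF module_C linear_maps_comp[OF comult_linear l] linear_maps_id _ assms])
    fix b assume "b \<in> B"
    then show "?l (comult C (gen b)) = gen b"
      by (cases rule: path_basis_cases)
        (simp_all add: comult_gen_simps counit_gen_simps linear_maps_add[OF l] pl arc_verts)
  qed
  show "?r (comult C c) = c"
  proof (rule linear_maps_C_eqI[OF module_C linear_maps_comp[OF comult_linear r] linear_maps_id _ assms])
    fix b assume "b \<in> B"
    then show "?r (comult C (gen b)) = gen b"
      by (cases rule: path_basis_cases)
        (simp_all add: comult_gen_simps counit_gen_simps linear_maps_add[OF r] pr arc_verts)
  qed
qed

text \<open>On a basis path both sides list the ways to cut it twice; they differ only in the order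
  and bracketing of the sum, hence \<open>R.M.a_ac\<close>.\<close>

lemma coassociative:
  assumes "c \<in> carrier C"
  shows "tensor_assoc K C C C (tensor_map K CC C (comult C) id (comult C c)) =
    tensor_map K C CC id (comult C) (comult C c)"
proof -
  have idl: "id \<in> linear_maps K C C" using linear_maps_id[of K C] by (simp add: id_def)
  note l = tensor_map_linear[OF module_C module_C module_CC module_C comult_linear idl]
  note pl = tensor_map_pure[OF module_C module_C module_CC module_C comult_linear idl]
  note r = tensor_map_linear[OF module_C module_C module_C module_CC idl comult_linear]
  note pr = tensor_map_pure[OF module_C module_C module_C module_CC idl comult_linear]
  note a = tensor_assoc_linear[OF module_C module_C module_C]
  note pa = tensor_assoc_pure[OF module_C module_C module_C]
  let ?L = "tensor_product K CC C" and ?R = "tensor_product K C CC"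
  have mR: "module K ?R" by (rule module_tensor_product[OF module_C module_CC])
  interpret R: module K ?R by (rule mR)
  note cl = pure_tensor_closed[OF module_CC module_C] pure_tensor_closed[OF module_C module_CC]
  note add = linear_maps_add[OF l] linear_maps_add[OF r] linear_maps_add[OF a]
    linear_maps_add[OF bilinear_maps_left[OF pure_tensor_bilinear[OF module_CC module_C]]]
    linear_maps_add[OF bilinear_maps_right[OF pure_tensor_bilinear[OF module_C module_CC]]]
  interpret L: module K ?L by (rule module_tensor_product[OF module_CC module_C])
  show ?thesis
  proof (rule linear_maps_C_eqI[OF mR linear_maps_comp[OF linear_maps_comp[OF comult_linear l] a]
        linear_maps_comp[OF comult_linear r] _ assms])
    fix b assume "b \<in> B"
    then show "tensor_assoc K C C C (tensor_map K CC C (comult C) id (comult C (gen b))) =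
        tensor_map K C CC id (comult C) (comult C (gen b))"
      by (cases rule: path_basis_cases)
        (simp_all add: comult_gen_simps add pl pr pa cl arc_verts R.M.a_ac)
  qed
qed

sublocale coalgebra K C
  by (intro coalgebra.intro coalgebra_axioms.intro field_axioms module_C comult_linear
      counit_linear coassociative counital)

text \<open>The tensor product of the coordinate functionals at \<open>x\<close> and
  \<open>y\<close>, a linear form on \<open>CC\<close>.\<close>

definition coeff :: "'v list \<Rightarrow> 'v list \<Rightarrow> (('v list \<Rightarrow> 'k) \<times> ('v list \<Rightarrow> 'k) \<Rightarrow> 'k) set \<Rightarrow> 'k"
  where "coeff x y = tensor_lift K (regular_module K) (\<lambda>u w. u x \<otimes> w y)"

lemma coeff_linear: "coeff x y \<in> linear_maps K CC (regular_module K)"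
  and coeff_tensor: "u \<in> carrier C \<Longrightarrow> w \<in> carrier C \<Longrightarrow> coeff x y (u \<otimes>\<^sub>C w) = u x \<otimes> w y"
proof -
  have b: "(\<lambda>u w. u x \<otimes> w y) \<in> bilinear_maps K C C (regular_module K)"
    by (intro bilinear_mapsI linear_mapsI)
      (simp_all add: C_add C_smult l_distr r_distr m_assoc m_lcomm)
  show "coeff x y \<in> linear_maps K CC (regular_module K)"
    unfolding coeff_def by (rule tensor_lift_linear[OF module_C module_C module_K b])
  show "u \<in> carrier C \<Longrightarrow> w \<in> carrier C \<Longrightarrow> coeff x y (u \<otimes>\<^sub>C w) = u x \<otimes> w y"
    unfolding coeff_def by (rule tensor_lift_pure[OF module_C module_C module_K b])
qed

lemma coeff_add: "s \<in> carrier CC \<Longrightarrow> t \<in> carrier CC \<Longrightarrow>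
    coeff x y (s \<oplus>\<^bsub>CC\<^esub> t) = coeff x y s \<oplus> coeff x y t"
  using linear_maps_add[OF coeff_linear] by simp

text \<open>Deconcatenation is dual to composition of paths; \<open>tl y\<close> drops the shared
  vertex, which is listed once in the composite. Composites outside \<open>B\<close> are covered as
  well, since \<open>u\<close> is zero there. Membership in \<open>B\<close> makes \<open>x\<close>
  and \<open>y\<close> nonempty, so that \<open>last\<close> and \<open>hd\<close> mean their end
  points.\<close>

lemma coeff_comult:
  assumes "u \<in> carrier C" "x \<in> B" "y \<in> B"
  shows "coeff x y (comult C u) = (if last x = hd y then u (x @ tl y) else \<zero>)"
proof (rule linear_maps_C_eqI[OF module_K linear_maps_comp[OF comult_linear coeff_linear] _ _ assms(1)])
  show "(\<lambda>u. if last x = hd y then u (x @ tl y) else \<zero>) \<in> linear_maps K C (regular_module K)"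
    by (rule linear_mapsI) (simp_all add: C_add C_smult)
  fix b assume "b \<in> B"
  then show "coeff x y (comult C (gen b)) = (if last x = hd y then gen b (x @ tl y) else \<zero>)"
    using assms(2,3)
    by (elim path_basis_cases)
      (auto simp: comult_gen_simps coeff_add coeff_tensor arc_verts gen_apply)
qed


lemma gen_eq_iff [simp]: "gen b = gen b' \<longleftrightarrow> b = b'"
  by (metis gen_apply one_not_zero)

lemma C_smult_apply: "(a \<odot>\<^bsub>C\<^esub> u) x = a \<otimes> u x"
  by (simp add: C_smult)

lemma inv_nonzero:
  assumes "h \<in> carrier K" "h \<noteq> \<zero>"
  shows "inv h \<in> carrier K" "inv h \<noteq> \<zero>" "h \<otimes> inv h = \<one>" "inv (inv h) = h"
  using assms field_Units Units_inv_Units[of h] Units_r_inv[of h] Units_inv_inv[of h] by auto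

lemma inv_mult_nonzero:
  assumes "h \<in> carrier K" "h \<noteq> \<zero>" "k \<in> carrier K" "k \<noteq> \<zero>"
  shows "inv (h \<otimes> k) = inv h \<otimes> inv k"
proof (rule comm_inv_char)
  have "h \<otimes> k \<otimes> (inv h \<otimes> inv k) = (h \<otimes> inv h) \<otimes> (k \<otimes> inv k)"
    using inv_nonzero(1)[OF assms(1,2)] inv_nonzero(1)[OF assms(3,4)] assms(1,3)
    by (simp only: m_ac m_closed)
  then show "h \<otimes> k \<otimes> (inv h \<otimes> inv k) = \<one>"
    using inv_nonzero[OF assms(1,2)] inv_nonzero[OF assms(3,4)] by simp
qed (use inv_nonzero[OF assms(1,2)] inv_nonzero[OF assms(3,4)] assms in auto)

subsection \<open>Grouplike elements\<close>

text \<open>By \<open>coeff_comult\<close> the function \<open>c\<close> is multiplicative on paths.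
  It vanishes on paths of positive length by nilpotency, and its values on the vertices are
  orthogonal idempotents of a field; the counit forces one of them to be nonzero.\<close>

lemma grouplikes_eq: "grouplikes K C = (\<lambda>v. gen [v]) ` pverts G"
proof (intro equalityI subsetI)
  fix c assume "c \<in> grouplikes K C"
  then have c: "c \<in> carrier C" "comult C c = c \<otimes>\<^sub>C c" "counit C c = \<one>"
    by (auto simp: grouplikes_def)
  have eq: "c x \<otimes> c y = (if last x = hd y then c (x @ tl y) else \<zero>)" if "x \<in> B" "y \<in> B" for x y
    using coeff_comult[OF c(1) that] coeff_tensor[OF c(1,1)] c(2) by simp
  \<comment> \<open>The square of \<open>c [v, v, v]\<close> is the coefficient at a path of length
    four, which lies outside the basis.\<close>
  have loop: "c [v, v, v] = \<zero>" for v
  proof (cases "[v, v, v] \<in> B")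
    case True
    then show ?thesis
      using eq[OF True True] C_apply_outside[OF c(1), of "[v, v, v, v, v]"] c(1)
      by (auto simp: integral_iff path_basis_def)
  qed (rule C_apply_outside[OF c(1)])
  \<comment> \<open>Here the square is zero or, for a loop, the coefficient at
    \<open>[v, v, v]\<close>, which has just been shown to vanish.\<close>
  have arc: "c [v, w] = \<zero>" if "(v, w) \<in> parcs G" for v w
    using eq[of "[v, w]" "[v, w]"] that loop c(1) by (auto simp: integral_iff split: if_splits)
  \<comment> \<open>Otherwise \<open>c\<close> would be zero, against
    \<open>counit C c = \<one>\<close>.\<close>
  have "\<exists>v\<in>pverts G. c [v] \<noteq> \<zero>"
  proof (rule ccontr)
    assume *: "\<not> ?thesis"
    have "c x = \<zero>" for x
    proof (cases "x \<in> B")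
      case True then show ?thesis using * loop arc by (elim path_basis_cases) auto
    qed (rule C_apply_outside[OF c(1)])
    then have "c = \<zero>\<^bsub>C\<^esub>" by (auto simp: C_zero)
    then show False using c(3) linear_maps_zero[OF module_C module_K counit_linear] by simp
  qed
  then obtain v where v: "v \<in> pverts G" "c [v] \<noteq> \<zero>" by blast
  have "c [v] \<otimes> c [v] = c [v] \<otimes> \<one>" using eq[of "[v]" "[v]"] v c(1) by simp
  then have "c [v] = \<one>" using v(2) c(1) m_lcancel[of "c [v]" "c [v]" \<one>]
      C_apply_closed[OF c(1), of "[v]"] one_closed by blast
  moreover have "c [w] = \<zero>" if "w \<in> pverts G" "w \<noteq> v" for w
    using eq[of "[v]" "[w]"] that v c(1) by (auto simp: integral_iff)
  ultimately have "c x = gen [v] x" for x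
  proof (cases "x \<in> B")
    case True
    with \<open>c [v] = \<one>\<close> loop arc \<open>\<And>w. w \<in> pverts G \<Longrightarrow> w \<noteq> v \<Longrightarrow> c [w] = \<zero>\<close> show ?thesis
      by (elim path_basis_cases) (auto simp: gen_apply)
  next
    case False
    then show ?thesis using C_apply_outside[OF c(1) False] v(1) by (auto simp: gen_apply)
  qed
  then have "c = gen [v]" ..
  then show "c \<in> (\<lambda>v. gen [v]) ` pverts G" using v(1) by blast
qed (auto simp: grouplikes_def comult_gen_simps counit_gen_simps)

lemma bij_betw_grouplikes: "bij_betw (\<lambda>v. gen [v]) (pverts G) (grouplikes K C)"
  by (auto simp: bij_betw_def grouplikes_eq inj_on_def)

subsection \<open>Skew-primitive elements\<close>

text \<open>The coordinates of \<open>c\<close> are isolated by suitable pairs of basis paths. If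
  \<open>(p, q)\<close> is not an arc, \<open>gen [p, q]\<close> lies outside \<open>C\<close>, but
  its coefficient \<open>c [p, q]\<close> is then zero and the equation still holds as one between
  functions.\<close>

lemma skew_primitive:
  assumes "p \<in> pverts G" "q \<in> pverts G" and c: "c \<in> carrier C"
    and comult: "comult C c = gen [p] \<otimes>\<^sub>C c \<oplus>\<^bsub>CC\<^esub> c \<otimes>\<^sub>C gen [q]"
  shows "c = c [p, q] \<odot>\<^bsub>C\<^esub> gen [p, q] \<oplus>\<^bsub>C\<^esub>
    (c [p] \<odot>\<^bsub>C\<^esub> gen [p] \<oplus>\<^bsub>C\<^esub> (\<ominus> c [p]) \<odot>\<^bsub>C\<^esub> gen [q])" (is "c = ?c")
proof
  fix x
  note cl [simp] = C_apply_closed[OF c]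
  have eq: "(if last x = hd y then c (x @ tl y) else \<zero>) = gen [p] x \<otimes> c y \<oplus> c x \<otimes> gen [q] y"
    if "x \<in> B" "y \<in> B" for x y
    using coeff_comult[OF c that] comult assms(1,2) c by (simp add: coeff_add coeff_tensor)
  show "c x = ?c x"
  proof (cases "x \<in> B")
    case True
    then show ?thesis
    proof (cases rule: path_basis_cases)
      case (1 u)
      \<comment> \<open>If \<open>u\<close> differs from \<open>p\<close> and \<open>q\<close> this
        says \<open>c [u] = 0\<close>; if \<open>u = p = q\<close> it says
        \<open>c [u] = c [u] + c [u]\<close>, with the same result.\<close>
      have u: "c [u] = gen [p] [u] \<otimes> c [u] \<oplus> c [u] \<otimes> gen [q] [u]"
        using eq[of "[u]" "[u]"] 1 by simp
      \<comment> \<open>Distinct vertices do not compose, so the left side of \<open>eq\<close> is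
        zero here.\<close>
      have pq: "\<zero> = c [q] \<oplus> c [p]" if "p \<noteq> q"
        using eq[of "[p]" "[q]"] that assms(1,2) by (simp add: gen_apply)
      show ?thesis
      proof (cases "p = q")
        case True
        then show ?thesis using u 1 by (auto simp: gen_apply C_add C_smult r_neg)
      next
        case False
        then have "c [q] = \<ominus> c [p]" using pq[OF False] by (simp add: minus_equality)
        then show ?thesis using u 1 False by (auto simp: gen_apply C_add C_smult)
      qed
    next
      case (2 u u')
      have "c [u, u'] = \<zero>" if "u \<noteq> p"
        using eq[of "[u]" "[u, u']"] 2 that arc_verts[of u u'] by (simp add: gen_apply)
      moreover have "c [u, u'] = \<zero>" if "u' \<noteq> q"
        using eq[of "[u, u']" "[u']"] 2 that arc_verts[of u u'] by (simp add: gen_apply)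
      ultimately show ?thesis
        using 2 by (auto simp: gen_apply C_add C_smult)
    next
      case (3 u)
      \<comment> \<open>Each term on the right has a vertex as one factor, so its coefficient at the
        pair \<open>[u, u]\<close>, \<open>[u, u]\<close> is zero.\<close>
      have "c [u, u, u] = \<zero>" using eq[of "[u, u]" "[u, u]"] 3 by (simp add: gen_apply)
      then show ?thesis using 3 by (simp add: gen_apply C_add C_smult)
    qed
  next
    case False
    then have "x \<noteq> [p]" "x \<noteq> [q]" "c x = \<zero>"
      using assms(1,2) C_apply_outside[OF c False] by auto
    then show ?thesis by (auto simp: gen_apply C_add C_smult)
  qed
qed

text \<open>The equation for \<open>comult C c\<close> is that of a second divided power of
  \<open>a [v, v]\<close>. It fixes the coefficient \<open>a^2\<close> of \<open>[v, v, v]\<close>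
  and leaves free only the addition of a multiple of the primitive element \<open>[v, v]\<close>;
  that is the second parameter of a loop.\<close>

lemma loop_divided_power:
  assumes v: "(v, v) \<in> parcs G" and a: "a \<in> carrier K" and c: "c \<in> carrier C"
    and comult: "comult C c = gen [v] \<otimes>\<^sub>C c \<oplus>\<^bsub>CC\<^esub>
      ((a \<odot>\<^bsub>C\<^esub> gen [v, v]) \<otimes>\<^sub>C (a \<odot>\<^bsub>C\<^esub> gen [v, v]) \<oplus>\<^bsub>CC\<^esub> c \<otimes>\<^sub>C gen [v])"
  shows "c = (a \<otimes> a) \<odot>\<^bsub>C\<^esub> gen [v, v, v] \<oplus>\<^bsub>C\<^esub> c [v, v] \<odot>\<^bsub>C\<^esub> gen [v, v]" (is "c = ?c")
proof
  fix x
  note cl [simp] = C_apply_closed[OF c]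
  have eq: "(if last x = hd y then c (x @ tl y) else \<zero>) =
      gen [v] x \<otimes> c y \<oplus> ((a \<otimes> gen [v, v] x) \<otimes> (a \<otimes> gen [v, v] y) \<oplus> c x \<otimes> gen [v] y)"
    if "x \<in> B" "y \<in> B" for x y
    using coeff_comult[OF c that] comult v a c arc_verts[OF v]
    by (simp add: coeff_add coeff_tensor C_smult_apply)
  show "c x = ?c x"
  proof (cases "x \<in> B")
    case True
    then show ?thesis
    proof (cases rule: path_basis_cases)
      case (1 u)
      \<comment> \<open>At \<open>u = v\<close> the two outer terms give
        \<open>c [v] = c [v] + c [v]\<close>.\<close>
      have "c [u] = \<zero>" using eq[of "[u]" "[u]"] 1 by (cases "u = v") (simp_all add: gen_apply a)
      then show ?thesis using 1 a by (simp add: gen_apply C_add C_smult)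
    next
      case (2 u u')
      have "c [u, u'] = \<zero>" if "u \<noteq> v"
        using eq[of "[u]" "[u, u']"] 2 that a arc_verts[of u u'] by (simp add: gen_apply)
      moreover have "c [u, u'] = \<zero>" if "u' \<noteq> v"
        using eq[of "[u, u']" "[u']"] 2 that a arc_verts[of u u'] by (simp add: gen_apply)
      ultimately show ?thesis using 2 a by (auto simp: gen_apply C_add C_smult)
    next
      case (3 u)
      have "c [u, u, u] = (if u = v then a \<otimes> a else \<zero>)"
        using eq[of "[u, u]" "[u, u]"] 3 a by (simp add: gen_apply)
      then show ?thesis using 3 a by (simp add: gen_apply C_add C_smult)
    qed
  next
    case False
    then have "x \<noteq> [v, v]" "x \<noteq> [v, v, v]" "c x = \<zero>"
      using v C_apply_outside[OF c False] by auto
    then show ?thesis using a by (auto simp: gen_apply C_add C_smult)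
  qed
qed

lemma end_comult_tensor:
  assumes "f \<in> coalgebra_end K C" "x \<in> carrier C" "y \<in> carrier C"
  shows "tensor_map K C C f f (x \<otimes>\<^sub>C y) = f x \<otimes>\<^sub>C f y"
  by (rule tensor_map_pure[OF module_C module_C module_C module_C]) (use assms coalgebra_end_linear in auto)

lemma end_tensor_map_add:
  assumes "f \<in> coalgebra_end K C" "s \<in> carrier CC" "t \<in> carrier CC"
  shows "tensor_map K C C f f (s \<oplus>\<^bsub>CC\<^esub> t) = tensor_map K C C f f s \<oplus>\<^bsub>CC\<^esub> tensor_map K C C f f t"
  by (rule linear_maps_add[OF tensor_map_linear[OF module_C module_C module_C module_C]])
    (use assms coalgebra_end_linear in auto)

text \<open>The image of an arc is skew-primitive for \<open>p\<close> and \<open>q\<close>. The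
  coefficient \<open>a\<close> cannot vanish, since the rest of the image already comes from a
  combination of vertices and \<open>f\<close> is injective; and a nonzero coordinate of an element
  of \<open>C\<close> belongs to a basis path, which yields the arc \<open>(p, q)\<close>.\<close>

lemma end_arc:
  assumes f: "f \<in> coalgebra_end K C" and inj: "inj_on f (carrier C)"
    and e: "(v, w) \<in> parcs G" and p: "p \<in> pverts G" "f (gen [v]) = gen [p]"
    and q: "q \<in> pverts G" "f (gen [w]) = gen [q]"
  obtains a b where "a \<in> carrier K" "a \<noteq> \<zero>" "b \<in> carrier K" "(p, q) \<in> parcs G"
    "f (gen [v, w]) = a \<odot>\<^bsub>C\<^esub> gen [p, q] \<oplus>\<^bsub>C\<^esub> (b \<odot>\<^bsub>C\<^esub> gen [p] \<oplus>\<^bsub>C\<^esub> (\<ominus> b) \<odot>\<^bsub>C\<^esub> gen [q])"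
proof -
  note fl = coalgebra_end_linear[OF f]
  let ?c = "f (gen [v, w])"
  have vw: "gen [v] \<in> carrier C" "gen [w] \<in> carrier C" "gen [v, w] \<in> carrier C"
    using e arc_verts[OF e] by simp_all
  have c: "?c \<in> carrier C" by (rule linear_maps_closed[OF fl vw(3)])
  have "comult C ?c = gen [p] \<otimes>\<^sub>C ?c \<oplus>\<^bsub>CC\<^esub> ?c \<otimes>\<^sub>C gen [q]"
    using coalgebra_end_comult[OF f vw(3)] vw e p q
    by (simp add: comult_gen_simps end_tensor_map_add[OF f] end_comult_tensor[OF f])
  note eq = skew_primitive[OF p(1) q(1) c this]
  let ?a = "?c [p, q]" and ?b = "?c [p]"
  have ab: "?a \<in> carrier K" "?b \<in> carrier K" using c by simp_all
  have "?a \<noteq> \<zero>"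
  proof
    assume "?a = \<zero>"
    let ?u = "?b \<odot>\<^bsub>C\<^esub> gen [v] \<oplus>\<^bsub>C\<^esub> (\<ominus> ?b) \<odot>\<^bsub>C\<^esub> gen [w]"
    have "f ?u = ?b \<odot>\<^bsub>C\<^esub> gen [p] \<oplus>\<^bsub>C\<^esub> (\<ominus> ?b) \<odot>\<^bsub>C\<^esub> gen [q]"
      using vw ab by (simp add: linear_maps_add[OF fl] linear_maps_smult[OF fl] p q)
    \<comment> \<open>At this point \<open>gen [p, q]\<close> might lie outside \<open>C\<close>, so
      the zero term is added pointwise.\<close>
    moreover have "\<dots> = \<zero> \<odot>\<^bsub>C\<^esub> gen [p, q] \<oplus>\<^bsub>C\<^esub> \<dots>"
      using p q ab by (simp add: C_add C_smult gen_apply fun_eq_iff)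
    ultimately have "f (gen [v, w]) = f ?u"
      using eq \<open>?a = \<zero>\<close> by metis
    then have "gen [v, w] = ?u"
      using inj vw ab by (auto dest: inj_onD)
    then have "gen [v, w] [v, w] = ?u [v, w]" by (rule arg_cong)
    then show False using ab by (simp add: C_add C_smult gen_apply)
  qed
  moreover have "(p, q) \<in> parcs G"
    using C_apply_outside[OF c, of "[p, q]"] \<open>?a \<noteq> \<zero>\<close> by auto
  ultimately show ?thesis using ab eq that by blast
qed

subsection \<open>Restriction to the vertices\<close>

abbreviation restriction :: "(('v list \<Rightarrow> 'k) \<Rightarrow> 'v list \<Rightarrow> 'k) \<Rightarrow> 'v \<Rightarrow> 'v"
  where "restriction \<equiv> grouplike_restriction K C (pverts G) (\<lambda>v. gen [v])"

lemma restriction_eqI: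
  assumes "v \<in> pverts G" "w \<in> pverts G" "f (gen [v]) = gen [w]"
  shows "restriction f v = w"
  using assms inv_into_f_f[of "\<lambda>v. gen [v]" "pverts G" w]
  by (simp add: grouplike_restriction_def grouplikes_eq inj_on_def)

lemma end_vertex:
  assumes f: "f \<in> coalgebra_end K C" and v: "v \<in> pverts G"
  shows "restriction f v \<in> pverts G" "f (gen [v]) = gen [restriction f v]"
proof -
  have "f (gen [v]) \<in> grouplikes K C"
    by (rule grouplikes_image[OF f]) (use v grouplikes_eq in auto)
  then obtain w where "w \<in> pverts G" "f (gen [v]) = gen [w]" by (auto simp: grouplikes_eq)
  then show "restriction f v \<in> pverts G" "f (gen [v]) = gen [restriction f v]"
    using restriction_eqI[of v w f] v by simp_all
qed

lemma coalgebra_autoD: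
  assumes "f \<in> coalgebra_auto K C"
  shows "f \<in> coalgebra_end K C" "f \<in> extensional (carrier C)" "inj_on f (carrier C)"
  using assms by (auto simp: coalgebra_auto_eq Bij_def bij_betw_def)

lemma coalgebra_auto_inverse:
  assumes "f \<in> coalgebra_auto K C"
  obtains g where "g \<in> coalgebra_auto K C"
    "\<And>c. c \<in> carrier C \<Longrightarrow> f (g c) = c" "\<And>c. c \<in> carrier C \<Longrightarrow> g (f c) = c"
proof -
  let ?g = "inv\<^bsub>coalgebra_AutoGroup K C\<^esub> f"
  interpret A: group "coalgebra_AutoGroup K C" by (rule group_coalgebra_AutoGroup)
  have f: "f \<in> carrier (coalgebra_AutoGroup K C)" using assms by (simp add: coalgebra_AutoGroup_simps)
  have g: "?g \<in> coalgebra_auto K C"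
    using A.inv_closed[OF f] by (simp add: coalgebra_AutoGroup_simps)
  have "compose (carrier C) f ?g = (\<lambda>c\<in>carrier C. c)" "compose (carrier C) ?g f = (\<lambda>c\<in>carrier C. c)"
    using A.r_inv[OF f] A.l_inv[OF f] assms g by (simp_all add: coalgebra_AutoGroup_simps)
  then have "f (?g c) = c" "?g (f c) = c" if "c \<in> carrier C" for c
    using that by (auto dest!: fun_cong[of _ _ c] simp: compose_eq)
  then show ?thesis using g that by blast
qed

lemma restriction_inverse:
  assumes f: "f \<in> coalgebra_end K C" and g: "g \<in> coalgebra_end K C"
    and gf: "\<And>c. c \<in> carrier C \<Longrightarrow> g (f c) = c" and v: "v \<in> pverts G"
  shows "restriction g (restriction f v) = v"
  using gf[of "gen [v]"] end_vertex[OF f v] v by (intro restriction_eqI) simp_all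

text \<open>\<open>end_arc\<close> yields only that arcs go to arcs. The reverse implication comes
  from the inverse automorphism; counting arcs would not do, as the digraph may be infinite.\<close>

lemma restriction_digraph_auto:
  assumes "f \<in> coalgebra_auto K C"
  shows "restriction f \<in> digraph_auto G"
proof -
  obtain g where "g \<in> coalgebra_auto K C"
    and inv: "\<And>c. c \<in> carrier C \<Longrightarrow> f (g c) = c" "\<And>c. c \<in> carrier C \<Longrightarrow> g (f c) = c"
    using coalgebra_auto_inverse[OF assms] by blast
  note f = coalgebra_autoD[OF assms] and g = coalgebra_autoD[OF \<open>g \<in> coalgebra_auto K C\<close>]
  note gf = restriction_inverse[OF f(1) g(1) inv(2)] and fg = restriction_inverse[OF g(1) f(1) inv(1)]
  have "bij_betw (restriction f) (pverts G) (pverts G)"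
    by (rule bij_betw_byWitness[where f' = "restriction g"])
      (use gf fg end_vertex(1)[OF f(1)] end_vertex(1)[OF g(1)] in auto)
  moreover have "restriction f \<in> extensional (pverts G)"
    by (simp add: grouplike_restriction_def)
  moreover have arc: "(restriction k v, restriction k w) \<in> parcs G"
    if "k \<in> coalgebra_end K C" "inj_on k (carrier C)" "(v, w) \<in> parcs G" for k v w
    using end_arc[OF that end_vertex[OF that(1)] end_vertex[OF that(1)]] arc_verts[OF that(3)] by blast
  moreover have "(v, w) \<in> parcs G" if "v \<in> pverts G" "w \<in> pverts G"
      "(restriction f v, restriction f w) \<in> parcs G" for v w
    using arc[OF g(1,3) that(3)] gf that by simp
  ultimately show ?thesis
    using f by (auto simp: digraph_auto_def Bij_def)
qed

lemma restriction_compose: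
  assumes f: "f \<in> coalgebra_end K C" and g: "g \<in> coalgebra_end K C"
  shows "restriction (compose (carrier C) f g) = compose (pverts G) (restriction f) (restriction g)"
proof
  fix v
  show "restriction (compose (carrier C) f g) v = compose (pverts G) (restriction f) (restriction g) v"
  proof (cases "v \<in> pverts G")
    case True
    show ?thesis
      using True end_vertex[OF g True] end_vertex[OF f end_vertex(1)[OF g True]]
      by (intro restriction_eqI) (simp_all add: compose_eq)
  next
    case False
    then show ?thesis by (simp add: grouplike_restriction_def compose_def)
  qed
qed


subsection \<open>Twisted permutations of the basis\<close>

lemma gen_apply_closed [simp]: "gen b x \<in> carrier K"
  by (simp add: gen_apply)

text \<open>Conjugating \<open>[v, w] \<mapsto> [v, w] + n ([v] - [w])\<close> by \<open>[v, w] \<mapsto> a [v, w]\<close> multiplies \<open>n\<close> by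
  \<open>a\<inverse>\<close>, so the factor \<open>h\<close> of the semidirect product has to act as \<open>a = h\<inverse>\<close>.\<close>

fun twist_gen :: "('v \<Rightarrow> 'v) \<Rightarrow> ('v \<times> 'v \<Rightarrow> 'k \<times> 'k) \<Rightarrow> 'v list \<Rightarrow> 'v list \<Rightarrow> 'k"
  where
    "twist_gen \<sigma> \<phi> [v] = gen [\<sigma> v]"
  | "twist_gen \<sigma> \<phi> [v, w] = (case \<phi> (v, w) of (n, h) \<Rightarrow>
      inv h \<odot>\<^bsub>C\<^esub> (gen [\<sigma> v, \<sigma> w] \<oplus>\<^bsub>C\<^esub>
        (n \<odot>\<^bsub>C\<^esub> gen [\<sigma> v] \<oplus>\<^bsub>C\<^esub> (\<ominus> n) \<odot>\<^bsub>C\<^esub> gen [\<sigma> w])))"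
  | "twist_gen \<sigma> \<phi> [u, v, w] = (case \<phi> (u, u) of (n, h) \<Rightarrow>
      (inv h \<otimes> inv h) \<odot>\<^bsub>C\<^esub> (gen [\<sigma> u, \<sigma> u, \<sigma> u] \<oplus>\<^bsub>C\<^esub> n \<odot>\<^bsub>C\<^esub> gen [\<sigma> u, \<sigma> u]))"
  | "twist_gen \<sigma> \<phi> _ = \<zero>\<^bsub>C\<^esub>"

text \<open>One family of maps serves both ends of the sequence: the identity for
  \<open>\<sigma>\<close> gives the kernel and a trivial \<open>\<phi>\<close> the section, so
  composition and compatibility with the coalgebra structure are verified once.\<close>

definition twist :: "('v \<Rightarrow> 'v) \<Rightarrow> ('v \<times> 'v \<Rightarrow> 'k \<times> 'k) \<Rightarrow> ('v list \<Rightarrow> 'k) \<Rightarrow> 'v list \<Rightarrow> 'k"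
  where "twist \<sigma> \<phi> = free_lift K C (twist_gen \<sigma> \<phi>)"

text \<open>These conditions keep \<open>twist_gen\<close> inside \<open>C\<close>. Invertibility of
  a twist is handled separately, by exhibiting a second twist that inverts it.\<close>

definition twisting :: "('v \<Rightarrow> 'v) \<Rightarrow> ('v \<times> 'v \<Rightarrow> 'k \<times> 'k) \<Rightarrow> bool"
  where "twisting \<sigma> \<phi> \<longleftrightarrow> (\<forall>v \<in> pverts G. \<sigma> v \<in> pverts G) \<and>
    (\<forall>(v, w) \<in> parcs G. (\<sigma> v, \<sigma> w) \<in> parcs G) \<and>
    (\<forall>e \<in> parcs G. \<phi> e \<in> carrier (affine_group K))"

lemma twistingD:
  assumes "twisting \<sigma> \<phi>"
  shows "v \<in> pverts G \<Longrightarrow> \<sigma> v \<in> pverts G"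
    and "(v, w) \<in> parcs G \<Longrightarrow> (\<sigma> v, \<sigma> w) \<in> parcs G"
    and "(v, w) \<in> parcs G \<Longrightarrow> \<phi> (v, w) = (n, h) \<Longrightarrow>
      n \<in> carrier K \<and> h \<in> carrier K \<and> h \<noteq> \<zero> \<and> inv h \<in> carrier K \<and> inv h \<noteq> \<zero> \<and> h \<otimes> inv h = \<one>"
proof -
  show "v \<in> pverts G \<Longrightarrow> \<sigma> v \<in> pverts G" using assms by (simp add: twisting_def)
  show "(v, w) \<in> parcs G \<Longrightarrow> (\<sigma> v, \<sigma> w) \<in> parcs G"
    using assms unfolding twisting_def by blast
  assume "(v, w) \<in> parcs G" "\<phi> (v, w) = (n, h)"
  then have "(n, h) \<in> carrier (affine_group K)" using assms unfolding twisting_def by metis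
  then show "n \<in> carrier K \<and> h \<in> carrier K \<and> h \<noteq> \<zero> \<and> inv h \<in> carrier K \<and> inv h \<noteq> \<zero> \<and> h \<otimes> inv h = \<one>"
    using inv_nonzero[of h] by (simp add: affine_group_simps)
qed

lemma
  assumes "twisting \<sigma> \<phi>"
  shows twist_linear: "twist \<sigma> \<phi> \<in> linear_maps K C C"
    and twist_apply_gen: "b \<in> B \<Longrightarrow> twist \<sigma> \<phi> (gen b) = twist_gen \<sigma> \<phi> b"
proof -
  have "twist_gen \<sigma> \<phi> b \<in> carrier C" if "b \<in> B" for b
    using that
  proof (cases rule: path_basis_cases)
    case (1 v)
    then show ?thesis using twistingD(1)[OF assms] by simp
  next
    case (2 v w)
    then show ?thesis
      using twistingD(2,3)[OF assms 2(2)] arc_verts[OF twistingD(2)[OF assms 2(2)]]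
      by (auto split: prod.split)
  next
    case (3 v)
    then show ?thesis
      using twistingD(2,3)[OF assms 3(2)] by (auto split: prod.split)
  qed
  then have cl: "twist_gen \<sigma> \<phi> \<in> B \<rightarrow> carrier C" by auto
  show "twist \<sigma> \<phi> \<in> linear_maps K C C"
    unfolding twist_def linear_maps_C by (rule free_lift_linear[OF module_C cl])
  show "twist \<sigma> \<phi> (gen b) = twist_gen \<sigma> \<phi> b" if "b \<in> B"
    unfolding twist_def by (rule free_lift_gen[OF module_C cl that])
qed

lemma twist_closed: "twisting \<sigma> \<phi> \<Longrightarrow> c \<in> carrier C \<Longrightarrow> twist \<sigma> \<phi> c \<in> carrier C"
  by (rule linear_maps_closed[OF twist_linear])

text \<open>Elements of the product group and of the permutation groups are \<open>undefined\<close>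
  outside the arcs and vertices; this compares them with the unrestricted expressions in
  \<open>twist_comp\<close>.\<close>

lemma twist_cong:
  assumes "twisting \<sigma> \<phi>" "\<And>v. v \<in> pverts G \<Longrightarrow> \<sigma>' v = \<sigma> v" "\<And>e. e \<in> parcs G \<Longrightarrow> \<phi>' e = \<phi> e"
    and "c \<in> carrier C"
  shows "twist \<sigma>' \<phi>' c = twist \<sigma> \<phi> c"
proof -
  have "(\<sigma>' v, \<sigma>' w) \<in> parcs G" if "(v, w) \<in> parcs G" for v w
    using twistingD(2)[OF assms(1) that] assms(2) arc_verts[OF that] by simp
  then have tw': "twisting \<sigma>' \<phi>'"
    using assms(1-3) by (auto simp: twisting_def)
  have "twist_gen \<sigma>' \<phi>' b = twist_gen \<sigma> \<phi> b" if "b \<in> B" for b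
    using that by (cases rule: path_basis_cases) (simp_all add: assms(2,3) arc_verts)
  then show ?thesis
    by (intro linear_maps_C_eqI[OF module_C twist_linear[OF tw'] twist_linear[OF assms(1)] _ assms(4)])
      (simp add: twist_apply_gen assms(1) tw')
qed

lemma twist_id:
  assumes "c \<in> carrier C"
  shows "twist (\<lambda>v. v) (\<lambda>e. (\<zero>, \<one>)) c = c"
proof -
  have tw: "twisting (\<lambda>v. v) (\<lambda>e. (\<zero>, \<one>))"
    by (auto simp: twisting_def affine_group_simps)
  have "twist_gen (\<lambda>v. v) (\<lambda>e. (\<zero>, \<one>)) b = gen b" if "b \<in> B" for b
    using that by (cases rule: path_basis_cases) (auto simp: C_add C_smult gen_apply fun_eq_iff)
  then show ?thesis
    by (intro linear_maps_C_eqI[OF module_C twist_linear[OF tw] linear_maps_id _ assms])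
      (simp add: twist_apply_gen tw)
qed

lemma twisting_comp:
  assumes "twisting \<sigma> \<phi>" "twisting \<sigma>' \<phi>'"
  shows "twisting (\<lambda>v. \<sigma> (\<sigma>' v)) (\<lambda>e. \<phi> (map_prod \<sigma>' \<sigma>' e) \<otimes>\<^bsub>affine_group K\<^esub> \<phi>' e)"
proof -
  interpret A: group "affine_group K" by (rule group_affine_group) (rule field_axioms)
  have "\<phi> (map_prod \<sigma>' \<sigma>' e) \<otimes>\<^bsub>affine_group K\<^esub> \<phi>' e \<in> carrier (affine_group K)"
    if "e \<in> parcs G" for e
  proof -
    obtain v w where e: "e = (v, w)" by (cases e)
    have "map_prod \<sigma>' \<sigma>' e \<in> parcs G" using twistingD(2)[OF assms(2)] that e by simp
    then show ?thesis using assms that by (intro A.m_closed) (simp_all add: twisting_def)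
  qed
  then show ?thesis
    unfolding twisting_def using twistingD(1,2)[OF assms(1)] twistingD(1,2)[OF assms(2)] by blast
qed

text \<open>With \<open>t = h^{-1}\<close> the factor \<open>h\<close> from the action in the
  semidirect product is absorbed. This is the scalar identity behind composition, for arcs and loops
  alike.\<close>

lemma affine_twist_scalar:
  assumes "n \<in> carrier K" "h \<in> carrier K" "n' \<in> carrier K" "s \<in> carrier K" "t \<in> carrier K"
    and "h \<otimes> t = \<one>"
  shows "s \<otimes> t \<otimes> (n \<oplus> h \<otimes> n') = s \<otimes> (t \<otimes> n \<oplus> n')"
proof -
  have "s \<otimes> t \<otimes> (n \<oplus> h \<otimes> n') = s \<otimes> (t \<otimes> n \<oplus> (h \<otimes> t) \<otimes> n')"
    using assms(1-5) by algebra
  then show ?thesis using assms by simp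
qed

text \<open>The inner twist moves an arc to its image under \<open>\<sigma>'\<close> before the
  outer parameter is read, so \<open>\<phi>\<close> is evaluated there. For identity permutations
  the result is the pointwise product of the parameters.\<close>

lemma twist_comp:
  assumes tw: "twisting \<sigma> \<phi>" and tw': "twisting \<sigma>' \<phi>'" and c: "c \<in> carrier C"
  shows "twist \<sigma> \<phi> (twist \<sigma>' \<phi>' c) =
    twist (\<lambda>v. \<sigma> (\<sigma>' v)) (\<lambda>e. \<phi> (map_prod \<sigma>' \<sigma>' e) \<otimes>\<^bsub>affine_group K\<^esub> \<phi>' e) c"
    (is "_ = twist ?\<sigma> ?\<phi> c")
proof (rule linear_maps_C_eqI[OF module_C linear_maps_comp[OF twist_linear[OF tw'] twist_linear[OF tw]]
      twist_linear[OF twisting_comp[OF tw tw']] _ c])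
  fix b assume b: "b \<in> B"
  note T = twist_apply_gen[OF tw] twist_apply_gen[OF tw'] twist_apply_gen[OF twisting_comp[OF tw tw']]
    linear_maps_add[OF twist_linear[OF tw]] linear_maps_smult[OF twist_linear[OF tw]]
  from b show "twist \<sigma> \<phi> (twist \<sigma>' \<phi>' (gen b)) = twist ?\<sigma> ?\<phi> (gen b)"
  proof (cases rule: path_basis_cases)
    case (1 v)
    then show ?thesis by (simp add: T twistingD[OF tw'])
  next
    case (2 v w)
    have arc: "(\<sigma>' v, \<sigma>' w) \<in> parcs G" by (rule twistingD(2)[OF tw' 2(2)])
    obtain n h where nh: "\<phi> (\<sigma>' v, \<sigma>' w) = (n, h)" by fastforce
    obtain n' h' where nh': "\<phi>' (v, w) = (n', h')" by fastforce
    note k = twistingD(3)[OF tw arc nh] and k' = twistingD(3)[OF tw' 2(2) nh']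
    have inv: "inv (h \<otimes> h') = inv h' \<otimes> inv h"
      using k k' inv_mult_nonzero[of h h'] by (simp add: m_comm)
    note comb = affine_twist_scalar[of n h n' "inv h'" "inv h"]
    \<comment> \<open>\<open>x\<close>, \<open>y\<close>, \<open>z\<close> stand for the values of
      \<open>?E\<close>, \<open>?P\<close>, \<open>?Q\<close> below at an arbitrary list, since the
      two functions are compared pointwise.\<close>
    have "inv h' \<otimes> (inv h \<otimes> (x \<oplus> (n \<otimes> y \<oplus> (\<ominus> n) \<otimes> z)) \<oplus> (n' \<otimes> y \<oplus> (\<ominus> n') \<otimes> z)) =
        inv h' \<otimes> inv h \<otimes> (x \<oplus> ((n \<oplus> h \<otimes> n') \<otimes> y \<oplus> (\<ominus> (n \<oplus> h \<otimes> n')) \<otimes> z))"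
      if "x \<in> carrier K" "y \<in> carrier K" "z \<in> carrier K" for x y z
    proof -
      have "inv h' \<otimes> inv h \<otimes> (x \<oplus> ((n \<oplus> h \<otimes> n') \<otimes> y \<oplus> (\<ominus> (n \<oplus> h \<otimes> n')) \<otimes> z)) =
          inv h' \<otimes> inv h \<otimes> x \<oplus> ((inv h' \<otimes> inv h \<otimes> (n \<oplus> h \<otimes> n')) \<otimes> y \<oplus>
          \<ominus> (inv h' \<otimes> inv h \<otimes> (n \<oplus> h \<otimes> n')) \<otimes> z)"
        using that k k' by algebra
      also have "\<dots> = inv h' \<otimes> (inv h \<otimes> (x \<oplus> (n \<otimes> y \<oplus> (\<ominus> n) \<otimes> z)) \<oplus> (n' \<otimes> y \<oplus> (\<ominus> n') \<otimes> z))"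
        using that k k' comb by algebra
      finally show ?thesis ..
    qed
    note scalars = this
    let ?P = "gen [\<sigma> (\<sigma>' v)]" and ?Q = "gen [\<sigma> (\<sigma>' w)]" and ?E = "gen [\<sigma> (\<sigma>' v), \<sigma> (\<sigma>' w)]"
    have "twist \<sigma> \<phi> (twist \<sigma>' \<phi>' (gen b)) =
        inv h' \<odot>\<^bsub>C\<^esub> (inv h \<odot>\<^bsub>C\<^esub> (?E \<oplus>\<^bsub>C\<^esub> (n \<odot>\<^bsub>C\<^esub> ?P \<oplus>\<^bsub>C\<^esub> (\<ominus> n) \<odot>\<^bsub>C\<^esub> ?Q)) \<oplus>\<^bsub>C\<^esub>
          (n' \<odot>\<^bsub>C\<^esub> ?P \<oplus>\<^bsub>C\<^esub> (\<ominus> n') \<odot>\<^bsub>C\<^esub> ?Q))"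
      using k k' 2 arc arc_verts[OF 2(2)] arc_verts[OF arc] by (simp add: T nh nh')
    also have "\<dots> = twist ?\<sigma> ?\<phi> (gen b)"
      using 2 by (simp add: T nh nh' affine_group_simps inv C_add C_smult scalars)
    finally show ?thesis .
  next
    case (3 v)
    have arc: "(\<sigma>' v, \<sigma>' v) \<in> parcs G" by (rule twistingD(2)[OF tw' 3(2)])
    obtain n h where nh: "\<phi> (\<sigma>' v, \<sigma>' v) = (n, h)" by fastforce
    obtain n' h' where nh': "\<phi>' (v, v) = (n', h')" by fastforce
    note k = twistingD(3)[OF tw arc nh] and k' = twistingD(3)[OF tw' 3(2) nh']
    have inv: "inv (h \<otimes> h') = inv h' \<otimes> inv h"
      using k k' inv_mult_nonzero[of h h'] by (simp add: m_comm)
    note comb = affine_twist_scalar[of n h n' "inv h'" "inv h"]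
    \<comment> \<open>Now \<open>x\<close>, \<open>y\<close>, \<open>z\<close> are the values of
      \<open>?W\<close>, \<open>?L\<close>, \<open>?P\<close>; the two \<open>z\<close> terms come
      from \<open>n ([v] - [w])\<close> with equal ends and cancel.\<close>
    have "(inv h' \<otimes> inv h') \<otimes> ((inv h \<otimes> inv h) \<otimes> (x \<oplus> n \<otimes> y) \<oplus>
          n' \<otimes> (inv h \<otimes> (y \<oplus> (n \<otimes> z \<oplus> (\<ominus> n) \<otimes> z)))) =
        (inv h' \<otimes> inv h \<otimes> (inv h' \<otimes> inv h)) \<otimes> (x \<oplus> (n \<oplus> h \<otimes> n') \<otimes> y)"
      if "x \<in> carrier K" "y \<in> carrier K" "z \<in> carrier K" for x y z
    proof -
      have "(inv h' \<otimes> inv h \<otimes> (inv h' \<otimes> inv h)) \<otimes> (x \<oplus> (n \<oplus> h \<otimes> n') \<otimes> y) =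
          (inv h' \<otimes> inv h) \<otimes> (inv h' \<otimes> inv h \<otimes> x \<oplus> (inv h' \<otimes> inv h \<otimes> (n \<oplus> h \<otimes> n')) \<otimes> y)"
        using that k k' by algebra
      also have "\<dots> = (inv h' \<otimes> inv h') \<otimes> ((inv h \<otimes> inv h) \<otimes> (x \<oplus> n \<otimes> y) \<oplus>
          n' \<otimes> (inv h \<otimes> (y \<oplus> (n \<otimes> z \<oplus> (\<ominus> n) \<otimes> z))))"
        using that k k' comb by algebra
      finally show ?thesis ..
    qed
    note scalars = this
    let ?P = "gen [\<sigma> (\<sigma>' v)]" and ?L = "gen [\<sigma> (\<sigma>' v), \<sigma> (\<sigma>' v)]"
      and ?W = "gen [\<sigma> (\<sigma>' v), \<sigma> (\<sigma>' v), \<sigma> (\<sigma>' v)]"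
    have "twist \<sigma> \<phi> (twist \<sigma>' \<phi>' (gen b)) =
        (inv h' \<otimes> inv h') \<odot>\<^bsub>C\<^esub> ((inv h \<otimes> inv h) \<odot>\<^bsub>C\<^esub> (?W \<oplus>\<^bsub>C\<^esub> n \<odot>\<^bsub>C\<^esub> ?L) \<oplus>\<^bsub>C\<^esub>
          n' \<odot>\<^bsub>C\<^esub> (inv h \<odot>\<^bsub>C\<^esub> (?L \<oplus>\<^bsub>C\<^esub> (n \<odot>\<^bsub>C\<^esub> ?P \<oplus>\<^bsub>C\<^esub> (\<ominus> n) \<odot>\<^bsub>C\<^esub> ?P))))"
      using k k' 3 arc arc_verts[OF 3(2)] arc_verts[OF arc] by (simp add: T nh nh')
    also have "\<dots> = twist ?\<sigma> ?\<phi> (gen b)"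
      using 3 by (simp add: T nh nh' affine_group_simps inv C_add C_smult scalars)
    finally show ?thesis .
  qed
qed

lemma twist_end:
  assumes tw: "twisting \<sigma> \<phi>"
  shows "twist \<sigma> \<phi> \<in> coalgebra_end K C"
proof -
  let ?f = "twist \<sigma> \<phi>"
  note fl = twist_linear[OF tw] and f = twist_apply_gen[OF tw]
  note ml = tensor_map_linear[OF module_C module_C module_C module_C fl fl]
  note mp = tensor_map_pure[OF module_C module_C module_C module_C fl fl]
  note tl = linear_maps_add[OF bilinear_maps_left[OF pure_tensor_bilinear[OF module_C module_C]]]
    linear_maps_add[OF bilinear_maps_right[OF pure_tensor_bilinear[OF module_C module_C]]]
    linear_maps_smult[OF bilinear_maps_left[OF pure_tensor_bilinear[OF module_C module_C]]]
    linear_maps_smult[OF bilinear_maps_right[OF pure_tensor_bilinear[OF module_C module_C]]]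
  note cl = linear_maps_add[OF comult_linear] linear_maps_smult[OF comult_linear]
  have "comult C (?f (gen b)) = tensor_map K C C ?f ?f (comult C (gen b))" if "b \<in> B" for b
    using that
  proof (cases rule: path_basis_cases)
    case (1 v)
    then show ?thesis using twistingD(1)[OF tw 1(2)] by (simp add: f comult_gen_simps mp)
  next
    case (2 v w)
    have arc: "(\<sigma> v, \<sigma> w) \<in> parcs G" by (rule twistingD(2)[OF tw 2(2)])
    obtain n h where nh: "\<phi> (v, w) = (n, h)" by fastforce
    note k = twistingD(3)[OF tw 2(2) nh]
    let ?P = "gen [\<sigma> v]" and ?Q = "gen [\<sigma> w]" and ?E = "gen [\<sigma> v, \<sigma> w]" and ?a = "inv h"
    have PQE: "?P \<in> carrier C" "?Q \<in> carrier C" "?E \<in> carrier C"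
      using arc arc_verts[OF arc] by simp_all
    \<comment> \<open>The mixed terms cancel in
      \<open>P \<otimes> (P - Q) + (P - Q) \<otimes> Q\<close>, which leaves
      \<open>P \<otimes> P - Q \<otimes> Q\<close>, the comultiplication of
      \<open>P - Q\<close>.\<close>
    have "n \<odot>\<^bsub>CC\<^esub> (?P \<otimes>\<^sub>C ?Q) \<oplus>\<^bsub>CC\<^esub> (\<ominus> n) \<odot>\<^bsub>CC\<^esub> (?P \<otimes>\<^sub>C ?Q) = \<zero>\<^bsub>CC\<^esub>"
      using k PQE by (simp add: r_neg flip: CC.smult_l_distr)
    note cancel = this
    have "comult C (?f (gen b)) = ?a \<odot>\<^bsub>CC\<^esub> (?P \<otimes>\<^sub>C ?E \<oplus>\<^bsub>CC\<^esub> ?E \<otimes>\<^sub>C ?Q \<oplus>\<^bsub>CC\<^esub>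
        (n \<odot>\<^bsub>CC\<^esub> (?P \<otimes>\<^sub>C ?P) \<oplus>\<^bsub>CC\<^esub> (\<ominus> n) \<odot>\<^bsub>CC\<^esub> (?Q \<otimes>\<^sub>C ?Q)))"
      using 2 k PQE arc arc_verts[OF arc] by (simp add: f nh cl comult_gen_simps)
    \<comment> \<open>Zero is inserted in the form of the mixed terms, so that the sum can be
      regrouped.\<close>
    also have "\<dots> = ?a \<odot>\<^bsub>CC\<^esub> (?P \<otimes>\<^sub>C ?E \<oplus>\<^bsub>CC\<^esub> ?E \<otimes>\<^sub>C ?Q \<oplus>\<^bsub>CC\<^esub>
        (n \<odot>\<^bsub>CC\<^esub> (?P \<otimes>\<^sub>C ?P) \<oplus>\<^bsub>CC\<^esub> (\<ominus> n) \<odot>\<^bsub>CC\<^esub> (?Q \<otimes>\<^sub>C ?Q)) \<oplus>\<^bsub>CC\<^esub>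
        (n \<odot>\<^bsub>CC\<^esub> (?P \<otimes>\<^sub>C ?Q) \<oplus>\<^bsub>CC\<^esub> (\<ominus> n) \<odot>\<^bsub>CC\<^esub> (?P \<otimes>\<^sub>C ?Q)))"
      unfolding cancel using k PQE by simp
    also have "\<dots> = tensor_map K C C ?f ?f (comult C (gen b))"
      using 2 k PQE arc_verts[OF 2(2)]
      by (simp add: comult_gen_simps linear_maps_add[OF ml] mp f nh tl CC.smult_r_distr CC.M.a_ac)
    finally show ?thesis .
  next
    case (3 v)
    have arc: "(\<sigma> v, \<sigma> v) \<in> parcs G" by (rule twistingD(2)[OF tw 3(2)])
    obtain n h where nh: "\<phi> (v, v) = (n, h)" by fastforce
    note k = twistingD(3)[OF tw 3(2) nh]
    \<comment> \<open>For a loop the vertex part of the twist is a multiple of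
      \<open>[v] - [v]\<close>, with \<open>v\<close> replaced by \<open>\<sigma> v\<close>.\<close>
    have "?f (gen [v, v]) = inv h \<odot>\<^bsub>C\<^esub> gen [\<sigma> v, \<sigma> v]"
      using 3(2) k by (simp add: f nh C_add C_smult gen_apply fun_eq_iff r_neg)
    note loop = this
    have PLW: "gen [\<sigma> v] \<in> carrier C" "gen [\<sigma> v, \<sigma> v] \<in> carrier C" "gen [\<sigma> v, \<sigma> v, \<sigma> v] \<in> carrier C"
      using arc arc_verts[OF arc] by simp_all
    \<comment> \<open>\<open>f\<close> is instantiated only at the other two paths; at
      \<open>[v, v]\<close> the rewriting has to use \<open>loop\<close>.\<close>
    note three = f[of "[v, v, v]"] f[of "[v]"]
    show ?thesis
      using 3 k PLW arc arc_verts[OF 3(2)] arc_verts[OF arc]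
      by (simp add: comult_gen_simps linear_maps_add[OF ml] mp three loop nh cl tl CC.smult_r_distr
          CC.M.a_ac m_assoc flip: CC.smult_assoc1)
  qed
  then have comult: "comult C (?f c) = tensor_map K C C ?f ?f (comult C c)" if "c \<in> carrier C" for c
    by (intro linear_maps_C_eqI[OF module_CC linear_maps_comp[OF fl comult_linear]
          linear_maps_comp[OF comult_linear ml] _ that])
  have add: "counit C (x \<oplus>\<^bsub>C\<^esub> y) = counit C x \<oplus> counit C y" if "x \<in> carrier C" "y \<in> carrier C" for x y
    using linear_maps_add[OF counit_linear that] by simp
  have smult: "counit C (a \<odot>\<^bsub>C\<^esub> x) = a \<otimes> counit C x" if "a \<in> carrier K" "x \<in> carrier C" for a x
    using linear_maps_smult[OF counit_linear that] by simp
  have "counit C (?f (gen b)) = counit C (gen b)" if "b \<in> B" for b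
    using that
  proof (cases rule: path_basis_cases)
    case (1 v)
    then show ?thesis using twistingD(1)[OF tw 1(2)] by (simp add: f counit_gen_simps)
  next
    case (2 v w)
    have arc: "(\<sigma> v, \<sigma> w) \<in> parcs G" by (rule twistingD(2)[OF tw 2(2)])
    obtain n h where nh: "\<phi> (v, w) = (n, h)" by fastforce
    show ?thesis
      using 2 twistingD(3)[OF tw 2(2) nh] arc arc_verts[OF arc]
      by (simp add: f nh counit_gen_simps add smult r_neg)
  next
    case (3 v)
    have arc: "(\<sigma> v, \<sigma> v) \<in> parcs G" by (rule twistingD(2)[OF tw 3(2)])
    obtain n h where nh: "\<phi> (v, v) = (n, h)" by fastforce
    show ?thesis
      using 3 twistingD(3)[OF tw 3(2) nh] arc
      by (simp add: f nh counit_gen_simps add smult)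
  qed
  then have "counit C (?f c) = counit C c" if "c \<in> carrier C" for c
    by (intro linear_maps_C_eqI[OF module_K linear_maps_comp[OF fl counit_linear] counit_linear _ that])
  then show ?thesis using comult fl by (simp add: coalgebra_end_def)
qed


subsection \<open>The split exact sequence\<close>

abbreviation "A \<equiv> affine_group K"

lemma group_A: "group A"
  by (rule group_affine_group) (rule field_axioms)

text \<open>The inverse is again a twist. By \<open>twist_comp\<close> both composites are twists,
  and \<open>inv\<close> says that their data are trivial on vertices and arcs.\<close>

lemma twist_auto:
  assumes tw: "twisting \<sigma> \<phi>" and tw': "twisting \<tau> \<psi>"
    and inv: "\<And>v. v \<in> pverts G \<Longrightarrow> \<sigma> (\<tau> v) = v" "\<And>v. v \<in> pverts G \<Longrightarrow> \<tau> (\<sigma> v) = v"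
      "\<And>e. e \<in> parcs G \<Longrightarrow> \<phi> (map_prod \<tau> \<tau> e) \<otimes>\<^bsub>A\<^esub> \<psi> e = \<one>\<^bsub>A\<^esub>"
      "\<And>e. e \<in> parcs G \<Longrightarrow> \<psi> (map_prod \<sigma> \<sigma> e) \<otimes>\<^bsub>A\<^esub> \<phi> e = \<one>\<^bsub>A\<^esub>"
  shows "restrict (twist \<sigma> \<phi>) (carrier C) \<in> coalgebra_auto K C"
proof (rule coalgebra_autoI[OF twist_end[OF tw] twist_closed[OF tw']])
  have tw1: "twisting (\<lambda>v. v) (\<lambda>e. (\<zero>, \<one>))"
    by (auto simp: twisting_def affine_group_simps)
  fix c assume c: "c \<in> carrier C"
  show "twist \<sigma> \<phi> (twist \<tau> \<psi> c) = c"
    unfolding twist_comp[OF tw tw' c]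
    by (subst twist_cong[OF tw1 _ _ c]) (simp_all add: inv twist_id c affine_group_simps(2))
  show "twist \<tau> \<psi> (twist \<sigma> \<phi> c) = c"
    unfolding twist_comp[OF tw' tw c]
    by (subst twist_cong[OF tw1 _ _ c]) (simp_all add: inv twist_id c affine_group_simps(2))
qed

lemma restriction_twist:
  assumes tw: "twisting \<sigma> \<phi>" and "v \<in> pverts G"
  shows "restriction (restrict (twist \<sigma> \<phi>) (carrier C)) v = \<sigma> v"
  by (rule restriction_eqI) (use assms twistingD(1)[OF tw] in \<open>simp_all add: twist_apply_gen[OF tw]\<close>)

section \<open>The embedding of the product group and its image\<close>

definition fiber_embedding :: "('v \<times> 'v \<Rightarrow> 'k \<times> 'k) \<Rightarrow> ('v list \<Rightarrow> 'k) \<Rightarrow> 'v list \<Rightarrow> 'k"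
  where "fiber_embedding \<phi> = restrict (twist (\<lambda>v. v) \<phi>) (carrier C)"

definition vertex_section :: "('v \<Rightarrow> 'v) \<Rightarrow> ('v list \<Rightarrow> 'k) \<Rightarrow> 'v list \<Rightarrow> 'k"
  where "vertex_section \<sigma> = restrict (twist \<sigma> (\<lambda>e. \<one>\<^bsub>A\<^esub>)) (carrier C)"

lemma twisting_fiber:
  "\<phi> \<in> (\<Pi>\<^sub>E e\<in>parcs G. carrier A) \<Longrightarrow> twisting (\<lambda>v. v) \<phi>"
  by (auto simp: twisting_def)

lemma fiber_embedding_auto:
  assumes "\<phi> \<in> (\<Pi>\<^sub>E e\<in>parcs G. carrier A)"
  shows "fiber_embedding \<phi> \<in> coalgebra_auto K C"
proof -
  interpret A: group A by (rule group_A)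
  have \<phi>: "\<phi> e \<in> carrier A" if "e \<in> parcs G" for e using assms that by auto
  have tw: "twisting (\<lambda>v. v) (\<lambda>e\<in>parcs G. inv\<^bsub>A\<^esub> \<phi> e)"
    by (rule twisting_fiber) (use \<phi> in auto)
  show ?thesis
    unfolding fiber_embedding_def
    by (rule twist_auto[OF twisting_fiber[OF assms] tw])
      (simp_all add: prod.map_ident \<phi>)
qed

lemma restriction_fiber_embedding:
  assumes "\<phi> \<in> (\<Pi>\<^sub>E e\<in>parcs G. carrier A)"
  shows "restriction (fiber_embedding \<phi>) = (\<lambda>v\<in>pverts G. v)"
proof
  fix v
  show "restriction (fiber_embedding \<phi>) v = (\<lambda>v\<in>pverts G. v) v"
    using restriction_twist[OF twisting_fiber[OF assms], of v]
    by (cases "v \<in> pverts G") (simp_all add: fiber_embedding_def grouplike_restriction_def)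
qed

lemma fiber_embedding_hom:
  "fiber_embedding \<in> hom (product_group (parcs G) (\<lambda>e. A)) (coalgebra_AutoGroup K C)"
proof (rule homI)
  interpret P: group "product_group (parcs G) (\<lambda>e. A)" by (rule product_group) (rule group_A)
  fix \<phi> assume "\<phi> \<in> carrier (product_group (parcs G) (\<lambda>e. A))"
  then have \<phi>: "\<phi> \<in> (\<Pi>\<^sub>E e\<in>parcs G. carrier A)" by simp
  show "fiber_embedding \<phi> \<in> carrier (coalgebra_AutoGroup K C)"
    using fiber_embedding_auto[OF \<phi>] by (simp add: coalgebra_AutoGroup_simps)
  fix \<psi> assume "\<psi> \<in> carrier (product_group (parcs G) (\<lambda>e. A))"
  then have \<psi>: "\<psi> \<in> (\<Pi>\<^sub>E e\<in>parcs G. carrier A)" by simp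
  let ?m = "\<phi> \<otimes>\<^bsub>product_group (parcs G) (\<lambda>e. A)\<^esub> \<psi>"
  note tw = twisting_fiber[OF \<phi>] and tw' = twisting_fiber[OF \<psi>]
  have "twist (\<lambda>v. v) ?m c = twist (\<lambda>v. v) \<phi> (twist (\<lambda>v. v) \<psi> c)" if c: "c \<in> carrier C" for c
    unfolding twist_comp[OF tw tw' c]
    by (rule twist_cong[OF twisting_comp[OF tw tw'] _ _ c]) (simp_all add: prod.map_ident)
  then have "fiber_embedding ?m = compose (carrier C) (fiber_embedding \<phi>) (fiber_embedding \<psi>)"
    unfolding fiber_embedding_def compose_def by (auto simp: fun_eq_iff twist_closed[OF tw'])
  then show "fiber_embedding ?m =
      fiber_embedding \<phi> \<otimes>\<^bsub>coalgebra_AutoGroup K C\<^esub> fiber_embedding \<psi>"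
    using fiber_embedding_auto[OF \<phi>] fiber_embedding_auto[OF \<psi>]
    by (simp only: coalgebra_AutoGroup_simps)
qed

text \<open>The parameters are coordinates of the images: \<open>h^{-1}\<close> at the arc itself,
  then \<open>n\<close>, up to a nonzero factor, at the first vertex. For a loop the vertex terms
  cancel, and \<open>n\<close> is read at \<open>[v, v]\<close> in the image of
  \<open>[v, v, v]\<close>.\<close>

lemma fiber_embedding_inj:
  "inj_on fiber_embedding (\<Pi>\<^sub>E e\<in>parcs G. carrier A)"
proof (rule inj_onI)
  fix \<phi> \<psi> assume \<phi>: "\<phi> \<in> (\<Pi>\<^sub>E e\<in>parcs G. carrier A)" and \<psi>: "\<psi> \<in> (\<Pi>\<^sub>E e\<in>parcs G. carrier A)"
    and eq: "fiber_embedding \<phi> = fiber_embedding \<psi>"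
  note tw = twisting_fiber[OF \<phi>] and tw' = twisting_fiber[OF \<psi>]
  have eq: "twist_gen (\<lambda>v. v) \<phi> b x = twist_gen (\<lambda>v. v) \<psi> b x" if "b \<in> B" for b x
  proof -
    have "fiber_embedding \<phi> (gen b) = fiber_embedding \<psi> (gen b)" using eq by simp
    then show ?thesis
      using that by (simp add: fiber_embedding_def twist_apply_gen[OF tw] twist_apply_gen[OF tw'])
  qed
  show "\<phi> = \<psi>"
  proof (rule PiE_ext[OF \<phi> \<psi>])
    fix e assume e: "e \<in> parcs G"
    obtain v w where vw: "e = (v, w)" by (cases e)
    obtain n h n' h' where nh: "\<phi> (v, w) = (n, h)" "\<psi> (v, w) = (n', h')" by fastforce
    have arc: "(v, w) \<in> parcs G" using e vw by simp
    note k = twistingD(3)[OF tw arc nh(1)] and k' = twistingD(3)[OF tw' arc nh(2)]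
    have "inv h = inv h'"
      using eq[of "[v, w]" "[v, w]"] arc k k' nh by (simp add: C_add C_smult gen_apply)
    then have h: "h = h'" using inv_nonzero(4)[of h] inv_nonzero(4)[of h'] k k' by metis
    have "n = n'"
    proof (cases "v = w")
      case True
      have "inv h \<otimes> inv h \<otimes> n = inv h \<otimes> inv h \<otimes> n'"
        using eq[of "[v, v, v]" "[v, v]"] arc k k' nh h True
        by (simp add: C_add C_smult gen_apply)
      then show ?thesis using k k' m_lcancel[of "inv h \<otimes> inv h" n n'] by (simp add: integral_iff)
    next
      case False
      have "inv h \<otimes> n = inv h \<otimes> n'"
        using eq[of "[v, w]" "[v]"] arc k k' nh h False
        by (simp add: C_add C_smult gen_apply)
      then show ?thesis using k k' m_lcancel[of "inv h" n n'] by simp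
    qed
    then show "\<phi> e = \<psi> e" using vw nh h by simp
  qed
qed

text \<open>The parameters are solved for arc by arc: \<open>end_arc\<close> supplies
  \<open>a\<close> and \<open>b\<close>, and for a loop \<open>loop_divided_power\<close> supplies
  the coefficient at \<open>[v, v]\<close>. The twist with these parameters agrees with
  \<open>f\<close> on the basis.\<close>

lemma fiber_embedding_surj:
  assumes f: "f \<in> coalgebra_auto K C" and res: "restriction f = (\<lambda>v\<in>pverts G. v)"
  shows "f \<in> fiber_embedding ` (\<Pi>\<^sub>E e\<in>parcs G. carrier A)"
proof -
  note f' = coalgebra_autoD[OF f]
  note fl = coalgebra_end_linear[OF f'(1)]
  have vert: "f (gen [v]) = gen [v]" if "v \<in> pverts G" for v
    using end_vertex(2)[OF f'(1) that] that by (simp add: res)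
  \<comment> \<open>Over a loop one pair \<open>p\<close> must serve both \<open>[v, v]\<close> and
    \<open>[v, v, v]\<close>. The constant function stands in for the family \<open>\<phi>\<close>,
    which is chosen only afterwards.\<close>
  have "\<exists>p\<in>carrier A. f (gen [v, w]) = twist_gen (\<lambda>v. v) (\<lambda>e. p) [v, w] \<and>
      (v = w \<longrightarrow> f (gen [v, v, v]) = twist_gen (\<lambda>v. v) (\<lambda>e. p) [v, v, v])"
    if arc: "(v, w) \<in> parcs G" for v w
  proof -
    have vw: "v \<in> pverts G" "w \<in> pverts G" using arc_verts[OF arc] by simp_all
    obtain a b where ab: "a \<in> carrier K" "a \<noteq> \<zero>" "b \<in> carrier K"
      and fe: "f (gen [v, w]) = a \<odot>\<^bsub>C\<^esub> gen [v, w] \<oplus>\<^bsub>C\<^esub> (b \<odot>\<^bsub>C\<^esub> gen [v] \<oplus>\<^bsub>C\<^esub> (\<ominus> b) \<odot>\<^bsub>C\<^esub> gen [w])"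
      using end_arc[OF f'(1,3) arc vw(1) vert[OF vw(1)] vw(2) vert[OF vw(2)]] by blast
    note a = inv_nonzero[OF ab(1,2)]
    show ?thesis
    proof (cases "v = w")
      case False
      \<comment> \<open>Comparing \<open>a e + b (v - w)\<close> with
        \<open>h^{-1} (e + n (v - w))\<close> gives \<open>h = a^{-1}\<close> and
        \<open>n = a^{-1} b\<close>.\<close>
      have "a \<otimes> (inv a \<otimes> b) = b" using a ab by (simp flip: m_assoc)
      moreover have "a \<otimes> \<ominus> (inv a \<otimes> b) = \<ominus> b"
        using a ab calculation by (simp add: r_minus)
      ultimately have "f (gen [v, w]) = twist_gen (\<lambda>v. v) (\<lambda>e. (inv a \<otimes> b, inv a)) [v, w]"
        using ab a arc vw
        by (simp add: fe C.smult_r_distr flip: C.smult_assoc1)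
      then show ?thesis
        using False a ab by (intro bexI[of _ "(inv a \<otimes> b, inv a)"]) (simp_all add: affine_group_simps)
    next
      case True
      let ?c = "f (gen [v, v, v])"
      have arc': "(v, v) \<in> parcs G" using arc True by simp
      have fe': "f (gen [v, v]) = a \<odot>\<^bsub>C\<^esub> gen [v, v]"
        using fe ab True by (simp add: C_add C_smult gen_apply fun_eq_iff r_neg)
      have c: "?c \<in> carrier C" using linear_maps_closed[OF fl] arc' by simp
      have "comult C ?c = gen [v] \<otimes>\<^sub>C ?c \<oplus>\<^bsub>CC\<^esub>
          ((a \<odot>\<^bsub>C\<^esub> gen [v, v]) \<otimes>\<^sub>C (a \<odot>\<^bsub>C\<^esub> gen [v, v]) \<oplus>\<^bsub>CC\<^esub> ?c \<otimes>\<^sub>C gen [v])"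
        using coalgebra_end_comult[OF f'(1), of "gen [v, v, v]"] arc' vw
        by (simp add: comult_gen_simps end_tensor_map_add[OF f'(1)] end_comult_tensor[OF f'(1)]
            vert fe')
      note ceq = loop_divided_power[OF arc' ab(1) c this]
      \<comment> \<open>With \<open>h = a^{-1}\<close> the witness \<open>?n\<close> solves
        \<open>a^2 n = ?b\<close>.\<close>
      let ?b = "?c [v, v]" and ?n = "inv a \<otimes> inv a \<otimes> ?c [v, v]"
      have b: "?b \<in> carrier K" using c by simp
      have "(a \<otimes> a) \<otimes> ?n = (a \<otimes> inv a) \<otimes> (a \<otimes> inv a) \<otimes> ?b"
        using ab(1) a(1) b by algebra
      then have n: "(a \<otimes> a) \<otimes> ?n = ?b" "?n \<in> carrier K" using a b by simp_all
      have "(a \<otimes> a) \<odot>\<^bsub>C\<^esub> (gen [v, v, v] \<oplus>\<^bsub>C\<^esub> ?n \<odot>\<^bsub>C\<^esub> gen [v, v]) =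
          (a \<otimes> a) \<odot>\<^bsub>C\<^esub> gen [v, v, v] \<oplus>\<^bsub>C\<^esub> ((a \<otimes> a) \<otimes> ?n) \<odot>\<^bsub>C\<^esub> gen [v, v]"
        using ab arc' n(2) by (simp add: C.smult_r_distr C.smult_assoc1)
      also have "\<dots> = ?c" unfolding n(1) using ceq by (rule sym)
      finally have "?c = twist_gen (\<lambda>v. v) (\<lambda>e. (?n, inv a)) [v, v, v]"
        using a by simp
      moreover have "f (gen [v, v]) = twist_gen (\<lambda>v. v) (\<lambda>e. (?n, inv a)) [v, v]"
        using fe' a n(2) by (simp add: C_add C_smult gen_apply fun_eq_iff r_neg)
      ultimately show ?thesis
        using True a n(2)
        by (intro bexI[of _ "(?n, inv a)"]) (simp_all add: affine_group_simps)
    qed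
  qed
  note ex = this
  \<comment> \<open>Arcs are accessed through \<open>fst\<close> and \<open>snd\<close>, so that the
    choice is made over the single variable \<open>e\<close>.\<close>
  let ?Q = "\<lambda>e p. p \<in> carrier A \<and>
      f (gen [fst e, snd e]) = twist_gen (\<lambda>v. v) (\<lambda>_. p) [fst e, snd e] \<and>
      (fst e = snd e \<longrightarrow>
        f (gen [fst e, fst e, fst e]) = twist_gen (\<lambda>v. v) (\<lambda>_. p) [fst e, fst e, fst e])"
  have "\<forall>e\<in>parcs G. \<exists>p. ?Q e p"
  proof
    fix e assume "e \<in> parcs G"
    then have "(fst e, snd e) \<in> parcs G" by simp
    from ex[OF this] show "\<exists>p. ?Q e p" by blast
  qed
  from bchoice[OF this] obtain \<phi>0 where \<phi>0: "\<forall>e\<in>parcs G. ?Q e (\<phi>0 e)" ..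
  \<comment> \<open>The chosen family is made extensional, as elements of the direct product
    are.\<close>
  define \<phi> where "\<phi> = restrict \<phi>0 (parcs G)"
  have \<phi>: "\<phi> \<in> (\<Pi>\<^sub>E e\<in>parcs G. carrier A)" using \<phi>0 by (auto simp: \<phi>_def)
  have \<phi>_eq: "\<phi> e = \<phi>0 e" if "e \<in> parcs G" for e using that by (simp add: \<phi>_def)
  note tw = twisting_fiber[OF \<phi>]
  have "f (gen b) = twist (\<lambda>v. v) \<phi> (gen b)" if "b \<in> B" for b
    using that
  proof (cases rule: path_basis_cases)
    case (1 v)
    then show ?thesis by (simp add: vert twist_apply_gen[OF tw])
  next
    case (2 v w)
    then show ?thesis using bspec[OF \<phi>0 2(2)] by (simp add: \<phi>_eq twist_apply_gen[OF tw])
  next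
    case (3 v)
    then show ?thesis using bspec[OF \<phi>0 3(2)] by (simp add: \<phi>_eq twist_apply_gen[OF tw])
  qed
  then have "f c = twist (\<lambda>v. v) \<phi> c" if "c \<in> carrier C" for c
    by (rule linear_maps_C_eqI[OF module_C fl twist_linear[OF tw] _ that])
  then have "f = fiber_embedding \<phi>"
    unfolding fiber_embedding_def using f'(2) by (intro extensionalityI[of f "carrier C"]) auto
  then show ?thesis using \<phi> by blast
qed

section \<open>The section and exactness\<close>

lemma twisting_section:
  assumes "\<sigma> \<in> digraph_auto G" shows "twisting \<sigma> (\<lambda>e. \<one>\<^bsub>A\<^esub>)"
proof -
  interpret A: group A by (rule group_A)
  have "\<sigma> v \<in> pverts G" if "v \<in> pverts G" for v
    using assms that Bij_imp_funcset[of \<sigma> "pverts G"] by (auto simp: digraph_auto_def)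
  moreover have "(\<sigma> v, \<sigma> w) \<in> parcs G" if "(v, w) \<in> parcs G" for v w
    using assms that arc_verts[OF that] by (auto simp: digraph_auto_def)
  ultimately show ?thesis by (auto simp: twisting_def)
qed

lemma vertex_section_auto:
  assumes \<sigma>: "\<sigma> \<in> digraph_auto G" shows "vertex_section \<sigma> \<in> coalgebra_auto K C"
proof -
  interpret A: group A by (rule group_A)
  let ?\<tau> = "inv\<^bsub>digraph_AutoGroup G\<^esub> \<sigma>"
  interpret D: group "digraph_AutoGroup G" by (rule group_digraph_AutoGroup)
  have c: "\<sigma> \<in> carrier (digraph_AutoGroup G)" using \<sigma> by (simp add: digraph_AutoGroup_simps)
  have \<tau>: "?\<tau> \<in> digraph_auto G"
    using D.inv_closed[OF c] by (simp add: digraph_AutoGroup_simps)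
  have "compose (pverts G) \<sigma> ?\<tau> = (\<lambda>v\<in>pverts G. v)" "compose (pverts G) ?\<tau> \<sigma> = (\<lambda>v\<in>pverts G. v)"
    using D.r_inv[OF c] D.l_inv[OF c] \<sigma> \<tau> by (simp_all add: digraph_AutoGroup_simps)
  then have "\<sigma> (?\<tau> v) = v" "?\<tau> (\<sigma> v) = v" if "v \<in> pverts G" for v
    using that by (auto dest!: fun_cong[of _ _ v] simp: compose_eq)
  then show ?thesis
    unfolding vertex_section_def
    by (intro twist_auto[OF twisting_section[OF \<sigma>] twisting_section[OF \<tau>]]) simp_all
qed

lemma restriction_vertex_section:
  assumes \<sigma>: "\<sigma> \<in> digraph_auto G" shows "restriction (vertex_section \<sigma>) = \<sigma>"
proof (rule extensionalityI[of _ "pverts G"])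
  show "restriction (vertex_section \<sigma>) \<in> extensional (pverts G)"
    by (simp add: grouplike_restriction_def)
  show "\<sigma> \<in> extensional (pverts G)" using \<sigma> by (simp add: digraph_auto_def Bij_def)
qed (simp add: vertex_section_def restriction_twist[OF twisting_section[OF \<sigma>]])

lemma vertex_section_hom: "vertex_section \<in> hom (digraph_AutoGroup G) (coalgebra_AutoGroup K C)"
proof (rule homI)
  interpret A: group A by (rule group_A)
  interpret D: group "digraph_AutoGroup G" by (rule group_digraph_AutoGroup)
  fix \<sigma> assume s: "\<sigma> \<in> carrier (digraph_AutoGroup G)"
  then have \<sigma>: "\<sigma> \<in> digraph_auto G" by (simp add: digraph_AutoGroup_simps)
  show "vertex_section \<sigma> \<in> carrier (coalgebra_AutoGroup K C)"
    using vertex_section_auto[OF \<sigma>] by (simp add: coalgebra_AutoGroup_simps)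
  fix \<tau> assume t: "\<tau> \<in> carrier (digraph_AutoGroup G)"
  then have \<tau>: "\<tau> \<in> digraph_auto G" by (simp add: digraph_AutoGroup_simps)
  note tw = twisting_section[OF \<sigma>] and tw' = twisting_section[OF \<tau>]
  have "twist (compose (pverts G) \<sigma> \<tau>) (\<lambda>e. \<one>\<^bsub>A\<^esub>) c = twist \<sigma> (\<lambda>e. \<one>\<^bsub>A\<^esub>) (twist \<tau> (\<lambda>e. \<one>\<^bsub>A\<^esub>) c)"
    if c: "c \<in> carrier C" for c
    unfolding twist_comp[OF tw tw' c]
    by (rule twist_cong[OF twisting_comp[OF tw tw'] _ _ c]) (simp_all add: compose_eq)
  then have "vertex_section (compose (pverts G) \<sigma> \<tau>) =
      compose (carrier C) (vertex_section \<sigma>) (vertex_section \<tau>)"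
    unfolding vertex_section_def compose_def[of "carrier C"]
    by (auto simp: fun_eq_iff twist_closed[OF tw'])
  then show "vertex_section (\<sigma> \<otimes>\<^bsub>digraph_AutoGroup G\<^esub> \<tau>) =
      vertex_section \<sigma> \<otimes>\<^bsub>coalgebra_AutoGroup K C\<^esub> vertex_section \<tau>"
    using vertex_section_auto[OF \<sigma>] vertex_section_auto[OF \<tau>] \<sigma> \<tau>
    by (simp only: coalgebra_AutoGroup_simps digraph_AutoGroup_simps)
qed

lemma restriction_hom: "restriction \<in> hom (coalgebra_AutoGroup K C) (digraph_AutoGroup G)"
  by (rule homI)
    (simp_all add: coalgebra_AutoGroup_simps digraph_AutoGroup_simps restriction_digraph_auto
      restriction_compose coalgebra_autoD(1))

lemma split_short_exact_restriction:
  "split_short_exact (product_group (parcs G) (\<lambda>e. A)) (coalgebra_AutoGroup K C)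
    (digraph_AutoGroup G) fiber_embedding restriction"
  unfolding split_short_exact_def
proof (intro conjI)
  show "group (product_group (parcs G) (\<lambda>e. A))" by (rule product_group) (rule group_A)
  show "group (coalgebra_AutoGroup K C)" by (rule group_coalgebra_AutoGroup)
  show "group (digraph_AutoGroup G)" by (rule group_digraph_AutoGroup)
  show "fiber_embedding \<in> mon (product_group (parcs G) (\<lambda>e. A)) (coalgebra_AutoGroup K C)"
    using fiber_embedding_hom fiber_embedding_inj by (simp add: mon_def)
  have sec: "\<sigma> = restriction (vertex_section \<sigma>) \<and> vertex_section \<sigma> \<in> coalgebra_auto K C"
    if "\<sigma> \<in> digraph_auto G" for \<sigma>
    using restriction_vertex_section[OF that] vertex_section_auto[OF that] by simp
  have "restriction ` coalgebra_auto K C = digraph_auto G"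
    using restriction_digraph_auto sec by blast
  then show "restriction \<in> epi (coalgebra_AutoGroup K C) (digraph_AutoGroup G)"
    using restriction_hom
    by (simp add: epi_def coalgebra_AutoGroup_simps digraph_AutoGroup_simps)
  have "fiber_embedding ` (\<Pi>\<^sub>E e\<in>parcs G. carrier A) =
      {f \<in> coalgebra_auto K C. restriction f = (\<lambda>v\<in>pverts G. v)}"
    using fiber_embedding_auto restriction_fiber_embedding fiber_embedding_surj by blast
  then show "fiber_embedding ` carrier (product_group (parcs G) (\<lambda>e. A)) =
      kernel (coalgebra_AutoGroup K C) (digraph_AutoGroup G) restriction"
    by (simp add: kernel_def coalgebra_AutoGroup_simps digraph_AutoGroup_simps)
  show "\<exists>s\<in>hom (digraph_AutoGroup G) (coalgebra_AutoGroup K C).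
      \<forall>h\<in>carrier (digraph_AutoGroup G). restriction (s h) = h"
    using vertex_section_hom restriction_vertex_section
    by (intro bexI[of _ vertex_section]) (simp_all add: digraph_AutoGroup_simps)
qed

end

theorem theorem1p1:
  fixes K :: "('k, 'r) ring_scheme" and G :: "'v pair_pre_digraph"
  assumes "field K" and "pair_wf_digraph G"
  shows "\<exists>(C :: ('k, 'v list \<Rightarrow> 'k) coalgebra) (\<gamma> :: 'v \<Rightarrow> 'v list \<Rightarrow> 'k).
    coalgebra K C \<and>
    bij_betw \<gamma> (pverts G) (grouplikes K C) \<and>
    (\<exists>i. split_short_exact
           (product_group (parcs G) (\<lambda>e. affine_group K))
           (coalgebra_AutoGroup K C)
           (digraph_AutoGroup G)
           i
           (grouplike_restriction K C (pverts G) \<gamma>))"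
proof -
  interpret digraph_coalgebra K G
    using assms by (rule digraph_coalgebra.intro)
  show ?thesis
    using coalgebra_axioms bij_betw_grouplikes split_short_exact_restriction by blast
qed

end
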